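(* Let $k$ be a field of characteristic $p>2$, let $R=W_2(k)$, and let $A$ be a smooth $R$-algebra with mod $p$ reduction $A_0$. Then there is an exact sequence of $A_0$-modules $$0\longrightarrow A_0\xrightarrow{\ \alpha\ }\Omega_A^{1,\mathrm{tot}}\xrightarrow{\ \beta\ }F_{A_0}^*\Omega^1_{A_0}\longrightarrow 0,$$ where $\alpha(x)=x\,d^{\mathrm{tot}}p$ and $\beta$ is the quotient map by the submodule generated by $d^{\mathrm{tot}}p$, given by $\beta(d^{\mathrm{tot}}a)=d(\pi_0(a))\otimes 1$ for $a\in A$, with $\pi_0\colon A\to A_0$ the reduction map.
   Context: All rings are commutative with $1$. $W_2(k)$ is the ring of $p$-typical Witt vectors of length $2$, and $\phi\colon R\to R$ is its Frobenius homomorphism. For $r\in R$, write $r$ also for $r\cdot 1\in A$. Set $C_p(X,Y)=\frac{X^p+Y^p-(X+Y)^p}{p}\in\mathbb{Z}[X,Y]$. For $r\in R$, $(\phi(r)-r^p)/p$ denotes the element $x\in k$ such that $p\tilde x=\phi(r)-r^p$ for any lift $\tilde x\in R$ of $x$. The mod $p$ reduction $A_0$ of $A$ is treated as a $k$-algebra. The module of total $p$-differentials $\Omega_A^{1,\mathrm{tot}}$ is the $A_0$-module generated by symbols $d^{\mathrm{tot}}x$ for $x\in A$ subject to the relations (1) $d^{\mathrm{tot}}(a+b)=d^{\mathrm{tot}}a+d^{\mathrm{tot}}b+C_p(a,b)\,d^{\mathrm{tot}}p$ for $a,b\in A$; (2) $d^{\mathrm{tot}}(ab)=b^p\,d^{\mathrm{tot}}a+a^p\,d^{\mathrm{tot}}b$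 for $a,b\in A$; (3) $d^{\mathrm{tot}}r=\frac{\phi(r)-r^p}{p}\,d^{\mathrm{tot}}p$ for $r\in R$, where $A$ acts through the reduction $A\to A_0$. $\Omega^1_{A_0}$ is the module of Kähler differentials of $A_0$ over $k$. For an $A_0$-module $M_0$, $F_{A_0}^*M_0=M_0\otimes_{A_0}A_0$, where the right-hand factor $A_0$ is an $A_0$-module via Frobenius ($r\cdot x=r^px$); it is an $A_0$-module through multiplication on the right-hand factor. *)

theory Defs
  imports "HOL-Algebra.Algebra"
begin

section \<open>Modules over a commutative ring\<close>

definition has_char :: "('r, 'x) ring_scheme \<Rightarrow> nat \<Rightarrow> bool" where
  "has_char R n \<longleftrightarrow> (\<forall>m::nat. [m] \<cdot>\<^bsub>R\<^esub> \<one>\<^bsub>R\<^esub> = \<zero>\<^bsub>R\<^esub> \<longleftrightarrow> n dvd m)"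

definition mod_hom ::
    "('r, 'x) ring_scheme \<Rightarrow> ('r, 'm, 'y) module_scheme \<Rightarrow> ('r, 'n, 'z) module_scheme \<Rightarrow> ('m \<Rightarrow> 'n) set"
  where "mod_hom R M N =
    {f \<in> carrier M \<rightarrow> carrier N.
      (\<forall>x\<in>carrier M. \<forall>y\<in>carrier M. f (x \<oplus>\<^bsub>M\<^esub> y) = f x \<oplus>\<^bsub>N\<^esub> f y) \<and>
      (\<forall>r\<in>carrier R. \<forall>x\<in>carrier M. f (r \<odot>\<^bsub>M\<^esub> x) = r \<odot>\<^bsub>N\<^esub> f x)}"

definition short_exact_modules ::
    "('r, 'x) ring_scheme \<Rightarrow> ('r, 'l, 'w) module_scheme \<Rightarrow> ('r, 'm, 'y) module_scheme \<Rightarrow>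
      ('r, 'n, 'z) module_scheme \<Rightarrow> ('l \<Rightarrow> 'm) \<Rightarrow> ('m \<Rightarrow> 'n) \<Rightarrow> bool"
  where "short_exact_modules R L M N f g \<longleftrightarrow>
    module R L \<and> module R M \<and> module R N \<and>
    f \<in> mod_hom R L M \<and> g \<in> mod_hom R M N \<and>
    inj_on f (carrier L) \<and>
    f ` carrier L = a_kernel M N g \<and>
    g ` carrier M = carrier N"

definition submodule_gen ::
    "('r, 'x) ring_scheme \<Rightarrow> ('r, 'm, 'y) module_scheme \<Rightarrow> 'm set \<Rightarrow> 'm set"
  where "submodule_gen R M G = \<Inter>{H. submodule H R M \<and> G \<subseteq> H}"

text \<open>The ring operations that every module record carries are meaningless for the
  following two modules.\<close>

definition quot_module :: "('r, 'm, 'y) module_scheme \<Rightarrow> 'm set \<Rightarrow> ('r, 'm set) module" where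
  "quot_module M H =
    \<lparr>carrier = a_rcosets\<^bsub>M\<^esub> H, monoid.mult = undefined, one = undefined,
     ring.zero = H, add = set_add M, smult = (\<lambda>r C. \<Union>x\<in>C. H +>\<^bsub>M\<^esub> (r \<odot>\<^bsub>M\<^esub> x))\<rparr>"

definition free_module :: "('r, 'x) ring_scheme \<Rightarrow> 's set \<Rightarrow> ('r, 's \<Rightarrow> 'r) module" where
  "free_module R S =
    \<lparr>carrier = {f. (\<forall>s\<in>S. f s \<in> carrier R) \<and> (\<forall>s. s \<notin> S \<longrightarrow> f s = \<zero>\<^bsub>R\<^esub>) \<and>
                  finite {s. f s \<noteq> \<zero>\<^bsub>R\<^esub>}},
     monoid.mult = undefined, one = undefined,
     ring.zero = (\<lambda>s. \<zero>\<^bsub>R\<^esub>), add = (\<lambda>f g s. f s \<oplus>\<^bsub>R\<^esub> g s), smult = (\<lambda>r f s. r \<otimes>\<^bsub>R\<^esub> f s)\<rparr>"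

definition free_gen :: "('r, 'x) ring_scheme \<Rightarrow> 's \<Rightarrow> 's \<Rightarrow> 'r" where
  "free_gen R s = (\<lambda>t. if t = s then \<one>\<^bsub>R\<^esub> else \<zero>\<^bsub>R\<^esub>)"

text \<open>The module generated by symbols \<open>s \<in> S\<close> subject to the relations \<open>\<rho> = 0\<close> for
  \<open>\<rho> \<in> Rel\<close>, and the class of the symbol \<open>s\<close> in it.\<close>

definition presented_module ::
    "('r, 'x) ring_scheme \<Rightarrow> 's set \<Rightarrow> ('s \<Rightarrow> 'r) set \<Rightarrow> ('r, ('s \<Rightarrow> 'r) set) module"
  where "presented_module R S Rel =
    quot_module (free_module R S) (submodule_gen R (free_module R S) Rel)"

definition presented_gen ::
    "('r, 'x) ring_scheme \<Rightarrow> 's set \<Rightarrow> ('s \<Rightarrow> 'r) set \<Rightarrow> 's \<Rightarrow> ('s \<Rightarrow> 'r) set"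
  where "presented_gen R S Rel s =
    submodule_gen R (free_module R S) Rel +>\<^bsub>free_module R S\<^esub> free_gen R s"


section \<open>Algebras\<close>

text \<open>The ring \<open>Q\<close> as an algebra along a ring homomorphism \<open>f\<close> into it.\<close>

definition algebra_via :: "('q, 'x) ring_scheme \<Rightarrow> ('r \<Rightarrow> 'q) \<Rightarrow> ('r, 'q) module" where
  "algebra_via Q f =
    \<lparr>carrier = carrier Q, monoid.mult = monoid.mult Q, one = \<one>\<^bsub>Q\<^esub>, ring.zero = \<zero>\<^bsub>Q\<^esub>, add = add Q,
     smult = (\<lambda>r x. f r \<otimes>\<^bsub>Q\<^esub> x)\<rparr>"

abbreviation self_module :: "('r, 'x) ring_scheme \<Rightarrow> ('r, 'r) module" where
  "self_module R \<equiv> algebra_via R (\<lambda>r. r)"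

definition alg_hom ::
    "('r, 'x) ring_scheme \<Rightarrow> ('r, 'a, 'y) module_scheme \<Rightarrow> ('r, 'b, 'z) module_scheme \<Rightarrow> ('a \<Rightarrow> 'b) set"
  where "alg_hom R A B =
    {f \<in> ring_hom A B. \<forall>r\<in>carrier R. \<forall>x\<in>carrier A. f (r \<odot>\<^bsub>A\<^esub> x) = r \<odot>\<^bsub>B\<^esub> f x}"

definition quot_algebra :: "('r, 'a, 'y) module_scheme \<Rightarrow> 'a set \<Rightarrow> ('r, 'a set) module" where
  "quot_algebra A J = algebra_via (A Quot J) (\<lambda>r. J +>\<^bsub>A\<^esub> (r \<odot>\<^bsub>A\<^esub> \<one>\<^bsub>A\<^esub>))"

text \<open>The polynomial algebra over \<open>R\<close> in variables indexed by \<open>I\<close>; monomials are multisets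
  of variables.\<close>

definition mpoly_algebra :: "('r, 'x) ring_scheme \<Rightarrow> 'i set \<Rightarrow> ('r, 'i multiset \<Rightarrow> 'r) module" where
  "mpoly_algebra R I =
    \<lparr>carrier = ring.indexed_pset R I (carrier R),
     monoid.mult = (\<lambda>P Q m. \<Oplus>\<^bsub>R\<^esub>a\<in>{a. a \<subseteq># m}. P a \<otimes>\<^bsub>R\<^esub> Q (m - a)),
     one = ring.indexed_const R \<one>\<^bsub>R\<^esub>,
     ring.zero = ring.indexed_const R \<zero>\<^bsub>R\<^esub>,
     add = ring.indexed_padd R,
     smult = (\<lambda>r P m. r \<otimes>\<^bsub>R\<^esub> P m)\<rparr>"

definition finitely_presented :: "('r, 'x) ring_scheme \<Rightarrow> ('r, 'a, 'y) module_scheme \<Rightarrow> bool" where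
  "finitely_presented R A \<longleftrightarrow>
    (\<exists>(n::nat) \<theta> G.
      \<theta> \<in> alg_hom R (mpoly_algebra R {..<n}) A \<and>
      \<theta> ` carrier (mpoly_algebra R {..<n}) = carrier A \<and>
      finite G \<and> G \<subseteq> carrier (mpoly_algebra R {..<n}) \<and>
      a_kernel (mpoly_algebra R {..<n}) A \<theta> = Idl\<^bsub>mpoly_algebra R {..<n}\<^esub> G)"

text \<open>The infinitesimal lifting property, for test algebras with elements in the type \<open>'u\<close>.\<close>

definition formally_smooth ::
    "'u itself \<Rightarrow> ('r, 'x) ring_scheme \<Rightarrow> ('r, 'a, 'y) module_scheme \<Rightarrow> bool"
  where "formally_smooth u R A \<longleftrightarrow>
    (\<forall>(B :: ('r, 'u) module) J.
      algebra R B \<and> ideal J B \<and> (\<forall>x\<in>J. \<forall>y\<in>J. x \<otimes>\<^bsub>B\<^esub> y = \<zero>\<^bsub>B\<^esub>) \<longrightarrow>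
      (\<forall>f\<in>alg_hom R A (quot_algebra B J).
        \<exists>g\<in>alg_hom R A B. \<forall>a\<in>carrier A. J +>\<^bsub>B\<^esub> g a = f a))"

text \<open>A definition cannot quantify over types, so a type of test algebras has to be chosen.
  Subsets of \<open>R[X\<^sub>0, X\<^sub>1, \<dots>]\<close> suffice: for \<open>A\<close> of finite type, a lifting problem
  \<open>A \<rightarrow> B/J\<close> can be solved in \<open>B\<close> if it can be solved in the subalgebra of \<open>B\<close> generated by
  lifts of the images of finitely many generators of \<open>A\<close>, and each finitely generated algebra
  is isomorphic to a quotient of \<open>R[X\<^sub>0, X\<^sub>1, \<dots>]\<close>, whose elements are such subsets.\<close>

definition smooth_algebra :: "('r, 'x) ring_scheme \<Rightarrow> ('r, 'a, 'y) module_scheme \<Rightarrow> bool" where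
  "smooth_algebra R A \<longleftrightarrow>
    algebra R A \<and> finitely_presented R A \<and> formally_smooth TYPE((nat multiset \<Rightarrow> 'r) set) R A"

definition kaehler_rels :: "('r, 'x) ring_scheme \<Rightarrow> ('r, 'b, 'y) module_scheme \<Rightarrow> ('b \<Rightarrow> 'b) set" where
  "kaehler_rels k B =
    (let F = free_module B (carrier B); d = free_gen B in
      {d (x \<oplus>\<^bsub>B\<^esub> y) \<ominus>\<^bsub>F\<^esub> (d x \<oplus>\<^bsub>F\<^esub> d y) | x y. x \<in> carrier B \<and> y \<in> carrier B} \<union>
      {d (x \<otimes>\<^bsub>B\<^esub> y) \<ominus>\<^bsub>F\<^esub> (y \<odot>\<^bsub>F\<^esub> d x \<oplus>\<^bsub>F\<^esub> x \<odot>\<^bsub>F\<^esub> d y) | x y. x \<in> carrier B \<and> y \<in> carrier B} \<union>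
      {d (c \<odot>\<^bsub>B\<^esub> \<one>\<^bsub>B\<^esub>) | c. c \<in> carrier k})"

definition kaehler :: "('r, 'x) ring_scheme \<Rightarrow> ('r, 'b, 'y) module_scheme \<Rightarrow> ('b, ('b \<Rightarrow> 'b) set) module" where
  "kaehler k B = presented_module B (carrier B) (kaehler_rels k B)"

definition kaehler_d :: "('r, 'x) ring_scheme \<Rightarrow> ('r, 'b, 'y) module_scheme \<Rightarrow> 'b \<Rightarrow> ('b \<Rightarrow> 'b) set" where
  "kaehler_d k B = presented_gen B (carrier B) (kaehler_rels k B)"

text \<open>Extension of scalars along a ring homomorphism \<open>f : B \<rightarrow> C\<close>, that is \<open>M \<otimes>\<^sub>B C\<close> with \<open>C\<close>
  acting on the right-hand factor: the \<open>C\<close>-module generated by the symbols \<open>m \<otimes> s\<close>. The last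
  family of relations says that \<open>C\<close> acts on the right-hand factor.\<close>

definition scalar_ext_rels ::
    "('b, 'x) ring_scheme \<Rightarrow> ('c, 'y) ring_scheme \<Rightarrow> ('b \<Rightarrow> 'c) \<Rightarrow> ('b, 'm, 'z) module_scheme \<Rightarrow>
      ('m \<times> 'c \<Rightarrow> 'c) set"
  where "scalar_ext_rels B C f M =
    (let F = free_module C (carrier M \<times> carrier C); t = (\<lambda>m s. free_gen C (m, s)) in
      {t (m \<oplus>\<^bsub>M\<^esub> m') s \<ominus>\<^bsub>F\<^esub> (t m s \<oplus>\<^bsub>F\<^esub> t m' s) | m m' s.
         m \<in> carrier M \<and> m' \<in> carrier M \<and> s \<in> carrier C} \<union>
      {t m (s \<oplus>\<^bsub>C\<^esub> s') \<ominus>\<^bsub>F\<^esub> (t m s \<oplus>\<^bsub>F\<^esub> t m s') | m s s'.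
         m \<in> carrier M \<and> s \<in> carrier C \<and> s' \<in> carrier C} \<union>
      {t (b \<odot>\<^bsub>M\<^esub> m) s \<ominus>\<^bsub>F\<^esub> t m (f b \<otimes>\<^bsub>C\<^esub> s) | b m s.
         b \<in> carrier B \<and> m \<in> carrier M \<and> s \<in> carrier C} \<union>
      {t m (c \<otimes>\<^bsub>C\<^esub> s) \<ominus>\<^bsub>F\<^esub> c \<odot>\<^bsub>F\<^esub> t m s | c m s.
         c \<in> carrier C \<and> m \<in> carrier M \<and> s \<in> carrier C})"

definition scalar_ext ::
    "('b, 'x) ring_scheme \<Rightarrow> ('c, 'y) ring_scheme \<Rightarrow> ('b \<Rightarrow> 'c) \<Rightarrow> ('b, 'm, 'z) module_scheme \<Rightarrow>
      ('c, ('m \<times> 'c \<Rightarrow> 'c) set) module"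
  where "scalar_ext B C f M =
    presented_module C (carrier M \<times> carrier C) (scalar_ext_rels B C f M)"

definition scalar_ext_tensor ::
    "('b, 'x) ring_scheme \<Rightarrow> ('c, 'y) ring_scheme \<Rightarrow> ('b \<Rightarrow> 'c) \<Rightarrow> ('b, 'm, 'z) module_scheme \<Rightarrow>
      'm \<Rightarrow> 'c \<Rightarrow> ('m \<times> 'c \<Rightarrow> 'c) set"
  where "scalar_ext_tensor B C f M m s =
    presented_gen C (carrier M \<times> carrier C) (scalar_ext_rels B C f M) (m, s)"

abbreviation frob_pullback ::
    "nat \<Rightarrow> ('b, 'x) ring_scheme \<Rightarrow> ('b, 'm, 'z) module_scheme \<Rightarrow> ('b, ('m \<times> 'b \<Rightarrow> 'b) set) module"
  where "frob_pullback p B M \<equiv> scalar_ext B B (\<lambda>b. b [^]\<^bsub>B\<^esub> p) M"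

abbreviation frob_tensor ::
    "nat \<Rightarrow> ('b, 'x) ring_scheme \<Rightarrow> ('b, 'm, 'z) module_scheme \<Rightarrow> 'm \<Rightarrow> 'b \<Rightarrow> ('m \<times> 'b \<Rightarrow> 'b) set"
  where "frob_tensor p B M \<equiv> scalar_ext_tensor B B (\<lambda>b. b [^]\<^bsub>B\<^esub> p) M"


section \<open>Witt vectors of length two\<close>

text \<open>The value of \<open>C\<^sub>p(X, Y) = (X\<^sup>p + Y\<^sup>p - (X + Y)\<^sup>p) / p\<close>, whose coefficients are the integers
  \<open>- (p choose i) / p\<close>, see \<open>Cp_coeff_int\<close> below.\<close>

definition Cp :: "('r, 'x) ring_scheme \<Rightarrow> nat \<Rightarrow> 'r \<Rightarrow> 'r \<Rightarrow> 'r" where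
  "Cp R p x y = \<ominus>\<^bsub>R\<^esub> (\<Oplus>\<^bsub>R\<^esub>i\<in>{1..<p}. [((p choose i) div p)] \<cdot>\<^bsub>R\<^esub> (x [^]\<^bsub>R\<^esub> i \<otimes>\<^bsub>R\<^esub> y [^]\<^bsub>R\<^esub> (p - i)))"

lemma sum_choose_div_prime:
  fixes x y :: "'a::comm_ring_1"
  assumes "Factorial_Ring.prime p"
  shows "of_nat p * (\<Sum>i\<in>{1..<p}. of_nat ((p choose i) div p) * (x ^ i * y ^ (p - i))) =
    (x + y) ^ p - x ^ p - y ^ p"
proof -
  have p: "0 < p" using assms prime_gt_0_nat by blast
  have "of_nat p * (\<Sum>i\<in>{1..<p}. of_nat ((p choose i) div p) * (x ^ i * y ^ (p - i))) =
      (\<Sum>i\<in>{1..<p}. of_nat (p choose i) * x ^ i * y ^ (p - i))"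
    unfolding sum_distrib_left
  proof (rule sum.cong)
    fix i assume "i \<in> {1..<p}"
    hence "p dvd (p choose i)" using dvd_choose_prime[of i p] assms by auto
    hence "of_nat p * of_nat ((p choose i) div p) = (of_nat (p choose i) :: 'a)"
      by (metis dvd_mult_div_cancel of_nat_mult)
    thus "of_nat p * (of_nat ((p choose i) div p) * (x ^ i * y ^ (p - i))) =
        of_nat (p choose i) * x ^ i * y ^ (p - i)"
      by (metis mult.assoc)
  qed simp
  moreover have "(x + y) ^ p = (\<Sum>i\<in>{1..<p}. of_nat (p choose i) * x ^ i * y ^ (p - i)) + x ^ p + y ^ p"
  proof -
    have "{..p} = insert 0 (insert p {1..<p})" using p by auto
    thus ?thesis unfolding binomial_ring using p by (simp add: algebra_simps)
  qed
  ultimately show ?thesis by simp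
qed

lemma Cp_coeff_int:
  assumes "Factorial_Ring.prime p"
  shows "int p * Cp \<Z> p x y = x ^ p + y ^ p - (x + y) ^ p"
proof -
  have a: "[n] \<cdot>\<^bsub>\<Z>\<^esub> z = int n * z" for n :: nat and z
    by (induction n) (auto simp: add_pow_def algebra_simps)
  have b: "z [^]\<^bsub>\<Z>\<^esub> n = z ^ n" for n :: nat and z
    by (induction n) (auto simp: mult.commute)
  have "Cp \<Z> p x y = - (\<Sum>i\<in>{1..<p}. int ((p choose i) div p) * (x ^ i * y ^ (p - i)))"
    unfolding Cp_def a b int_finsum_eq int_a_inv_eq by simp
  thus ?thesis using sum_choose_div_prime[OF assms, of x y] by (simp add: algebra_simps)
qed

definition witt2 :: "nat \<Rightarrow> ('k, 'x) ring_scheme \<Rightarrow> ('k \<times> 'k) ring" where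
  "witt2 p k =
    \<lparr>carrier = carrier k \<times> carrier k,
     monoid.mult = (\<lambda>(a0, a1) (b0, b1).
       (a0 \<otimes>\<^bsub>k\<^esub> b0,
        a0 [^]\<^bsub>k\<^esub> p \<otimes>\<^bsub>k\<^esub> b1 \<oplus>\<^bsub>k\<^esub> b0 [^]\<^bsub>k\<^esub> p \<otimes>\<^bsub>k\<^esub> a1 \<oplus>\<^bsub>k\<^esub> [p] \<cdot>\<^bsub>k\<^esub> (a1 \<otimes>\<^bsub>k\<^esub> b1))),
     one = (\<one>\<^bsub>k\<^esub>, \<zero>\<^bsub>k\<^esub>),
     ring.zero = (\<zero>\<^bsub>k\<^esub>, \<zero>\<^bsub>k\<^esub>),
     add = (\<lambda>(a0, a1) (b0, b1). (a0 \<oplus>\<^bsub>k\<^esub> b0, a1 \<oplus>\<^bsub>k\<^esub> b1 \<oplus>\<^bsub>k\<^esub> Cp k p a0 b0))\<rparr>"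

text \<open>The following formula for the Frobenius is correct because \<open>k\<close> has characteristic \<open>p\<close>.\<close>

definition witt2_frob :: "nat \<Rightarrow> ('k, 'x) ring_scheme \<Rightarrow> 'k \<times> 'k \<Rightarrow> 'k \<times> 'k" where
  "witt2_frob p k = (\<lambda>(a0, a1). (a0 [^]\<^bsub>k\<^esub> p, a1 [^]\<^bsub>k\<^esub> p))"

text \<open>\<open>(\<phi>(r) - r\<^sup>p) / p \<in> k\<close>; the lifts of \<open>x\<close> are the Witt vectors with first component \<open>x\<close>.\<close>

definition witt2_delta :: "nat \<Rightarrow> ('k, 'x) ring_scheme \<Rightarrow> 'k \<times> 'k \<Rightarrow> 'k" where
  "witt2_delta p k r =
    (THE x. x \<in> carrier k \<and>
      (\<forall>x'\<in>carrier (witt2 p k). fst x' = x \<longrightarrow>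
        [p] \<cdot>\<^bsub>witt2 p k\<^esub> x' = witt2_frob p k r \<ominus>\<^bsub>witt2 p k\<^esub> (r [^]\<^bsub>witt2 p k\<^esub> p)))"

text \<open>The reduction \<open>A\<^sub>0 = A \<otimes>\<^bsub>R\<^esub> k\<close> of an algebra \<open>A\<close> over \<open>R = W\<^sub>2(k)\<close>, as the quotient by the
  ideal generated by the kernel of \<open>R \<rightarrow> k\<close>. For perfect \<open>k\<close> this ideal is \<open>p A\<close>, see
  \<open>red_ideal_perfect\<close> below. For imperfect \<open>k\<close>, the kernel of \<open>R \<rightarrow> k\<close> is not \<open>p R\<close> and \<open>A / p A\<close>
  is not naturally a \<open>k\<close>-algebra.\<close>

definition red_ideal :: "('k, 'x) ring_scheme \<Rightarrow> nat \<Rightarrow> ('k \<times> 'k, 'a, 'y) module_scheme \<Rightarrow> 'a set" where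
  "red_ideal k p A = Idl\<^bsub>A\<^esub> {r \<odot>\<^bsub>A\<^esub> \<one>\<^bsub>A\<^esub> | r. r \<in> carrier (witt2 p k) \<and> fst r = \<zero>\<^bsub>k\<^esub>}"

lemma witt2_p_one:
  assumes k: "cring k" and ch: "has_char k p" and p: "Factorial_Ring.prime p"
  shows "[p] \<cdot>\<^bsub>witt2 p k\<^esub> \<one>\<^bsub>witt2 p k\<^esub> = (\<zero>\<^bsub>k\<^esub>, \<one>\<^bsub>k\<^esub>)"
proof -
  interpret k: cring k by (fact k)
  define S where "S n = (\<Sum>i\<in>{1..<p}. ((p choose i) div p) * n ^ i)" for n :: nat
  have pow: "([n] \<cdot>\<^bsub>k\<^esub> \<one>\<^bsub>k\<^esub>) [^]\<^bsub>k\<^esub> i = [(n ^ i)] \<cdot>\<^bsub>k\<^esub> \<one>\<^bsub>k\<^esub>" for n i :: nat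
    by (induction i) (auto simp: k.add_pow_rdistr k.add.nat_pow_pow mult.commute)
  have fin: "finsum k (\<lambda>i. [(f i :: nat)] \<cdot>\<^bsub>k\<^esub> \<one>\<^bsub>k\<^esub>) I = [(sum f I)] \<cdot>\<^bsub>k\<^esub> \<one>\<^bsub>k\<^esub>"
    if "finite I" for f and I :: "nat set"
    using that by (induction I) (auto simp: k.add.nat_pow_mult)
  have Cp: "Cp k p ([n] \<cdot>\<^bsub>k\<^esub> \<one>\<^bsub>k\<^esub>) \<one>\<^bsub>k\<^esub> = \<ominus>\<^bsub>k\<^esub> ([(S n)] \<cdot>\<^bsub>k\<^esub> \<one>\<^bsub>k\<^esub>)" for n :: nat
    unfolding Cp_def S_def by (simp add: pow k.add.nat_pow_pow mult.commute flip: fin)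
  have mult: "[n] \<cdot>\<^bsub>witt2 p k\<^esub> \<one>\<^bsub>witt2 p k\<^esub> =
      ([n] \<cdot>\<^bsub>k\<^esub> \<one>\<^bsub>k\<^esub>, \<ominus>\<^bsub>k\<^esub> ([(\<Sum>m<n. S m)] \<cdot>\<^bsub>k\<^esub> \<one>\<^bsub>k\<^esub>))" for n :: nat
  proof (induction n)
    case 0
    show ?case by (simp add: add_pow_def witt2_def)
  next
    case (Suc n)
    have "[Suc n] \<cdot>\<^bsub>witt2 p k\<^esub> \<one>\<^bsub>witt2 p k\<^esub> =
        [n] \<cdot>\<^bsub>witt2 p k\<^esub> \<one>\<^bsub>witt2 p k\<^esub> \<oplus>\<^bsub>witt2 p k\<^esub> \<one>\<^bsub>witt2 p k\<^esub>"
      by (simp add: add_pow_def)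
    thus ?case unfolding Suc
      by (simp add: witt2_def Cp k.minus_add flip: k.add.nat_pow_mult)
  qed
  have "int p * int (\<Sum>m<n. S m) = int n ^ p - int n" for n
  proof (induction n)
    case 0
    show ?case using p prime_gt_0_nat by auto
  next
    case (Suc n)
    have "int p * int (S n) = (int n + 1) ^ p - int n ^ p - 1"
      using sum_choose_div_prime[OF p, of "int n" 1] by (simp add: S_def)
    thus ?case using Suc by (simp add: algebra_simps)
  qed
  from this[of p] have "int p * int (\<Sum>m<p. S m) = int p * (int p ^ (p - 1) - 1)"
    using p prime_gt_0_nat[of p] by (simp add: right_diff_distrib flip: power_Suc)
  hence "int (\<Sum>m<p. S m) + 1 = int (p ^ (p - 1))" using p prime_gt_0_nat[of p] by simp
  hence "(\<Sum>m<p. S m) + 1 = p ^ (p - 1)" by (metis of_nat_1 of_nat_add of_nat_eq_iff)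
  moreover have "p dvd p ^ (p - 1)" using prime_ge_2_nat[OF p] by simp
  ultimately have "[((\<Sum>m<p. S m) + 1)] \<cdot>\<^bsub>k\<^esub> \<one>\<^bsub>k\<^esub> = \<zero>\<^bsub>k\<^esub>"
    using ch unfolding has_char_def by metis
  hence "[(\<Sum>m<p. S m)] \<cdot>\<^bsub>k\<^esub> \<one>\<^bsub>k\<^esub> \<oplus>\<^bsub>k\<^esub> \<one>\<^bsub>k\<^esub> = \<zero>\<^bsub>k\<^esub>" by (simp add: add_pow_def)
  hence "\<ominus>\<^bsub>k\<^esub> ([(\<Sum>m<p. S m)] \<cdot>\<^bsub>k\<^esub> \<one>\<^bsub>k\<^esub>) = \<one>\<^bsub>k\<^esub>"
    by (metis k.add.nat_pow_closed k.minus_equality k.a_comm k.one_closed)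
  moreover have "[p] \<cdot>\<^bsub>k\<^esub> \<one>\<^bsub>k\<^esub> = \<zero>\<^bsub>k\<^esub>" using ch by (simp add: has_char_def)
  ultimately show ?thesis using mult[of p] by simp
qed

lemma red_ideal_perfect:
  assumes k: "cring k" and ch: "has_char k p" and p: "Factorial_Ring.prime p"
    and perfect: "\<And>x. x \<in> carrier k \<Longrightarrow> \<exists>y\<in>carrier k. y [^]\<^bsub>k\<^esub> p = x"
    and A: "algebra (witt2 p k) A"
  shows "red_ideal k p A = Idl\<^bsub>A\<^esub> {[p] \<cdot>\<^bsub>A\<^esub> \<one>\<^bsub>A\<^esub>}"
proof -
  let ?W = "witt2 p k"
  let ?K = "{r \<odot>\<^bsub>A\<^esub> \<one>\<^bsub>A\<^esub> | r. r \<in> carrier ?W \<and> fst r = \<zero>\<^bsub>k\<^esub>}"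
  interpret k: cring k by (fact k)
  interpret A: algebra ?W A by (fact A)
  have rA: "ring A" using A.M_cring cring.axioms(1) by blast
  have one: "[n] \<cdot>\<^bsub>A\<^esub> \<one>\<^bsub>A\<^esub> = ([n] \<cdot>\<^bsub>?W\<^esub> \<one>\<^bsub>?W\<^esub>) \<odot>\<^bsub>A\<^esub> \<one>\<^bsub>A\<^esub>" for n :: nat
  proof (induction n)
    case 0
    show ?case by (simp add: add_pow_def)
  next
    case (Suc n)
    have "[n] \<cdot>\<^bsub>?W\<^esub> \<one>\<^bsub>?W\<^esub> \<in> carrier ?W" by simp
    thus ?case using Suc by (simp add: add_pow_def A.smult_l_distr)
  qed
  have pA: "[p] \<cdot>\<^bsub>A\<^esub> \<one>\<^bsub>A\<^esub> = (\<zero>\<^bsub>k\<^esub>, \<one>\<^bsub>k\<^esub>) \<odot>\<^bsub>A\<^esub> \<one>\<^bsub>A\<^esub>"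
    unfolding one witt2_p_one[OF k ch p] ..
  have mem: "[p] \<cdot>\<^bsub>A\<^esub> \<one>\<^bsub>A\<^esub> \<in> ?K" unfolding pA by (force simp: witt2_def)
  have sub: "?K \<subseteq> Idl\<^bsub>A\<^esub> {[p] \<cdot>\<^bsub>A\<^esub> \<one>\<^bsub>A\<^esub>}"
  proof clarify
    fix a0 a1 assume "(a0, a1) \<in> carrier ?W" "fst (a0, a1) = \<zero>\<^bsub>k\<^esub>"
    hence a: "a0 = \<zero>\<^bsub>k\<^esub>" "a1 \<in> carrier k" by (auto simp: witt2_def)
    obtain c where c: "c \<in> carrier k" "c [^]\<^bsub>k\<^esub> p = a1" using perfect[OF a(2)] by blast
    have z: "\<zero>\<^bsub>k\<^esub> [^]\<^bsub>k\<^esub> p = \<zero>\<^bsub>k\<^esub>" using prime_gt_0_nat[OF p] by (simp add: k.nat_pow_zero)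
    have W: "(c, \<zero>\<^bsub>k\<^esub>) \<in> carrier ?W" "(\<zero>\<^bsub>k\<^esub>, \<one>\<^bsub>k\<^esub>) \<in> carrier ?W"
      using c by (auto simp: witt2_def)
    have "(a0, a1) = (c, \<zero>\<^bsub>k\<^esub>) \<otimes>\<^bsub>?W\<^esub> (\<zero>\<^bsub>k\<^esub>, \<one>\<^bsub>k\<^esub>)"
      using a c z by (simp add: witt2_def)
    hence "(a0, a1) \<odot>\<^bsub>A\<^esub> \<one>\<^bsub>A\<^esub> = (c, \<zero>\<^bsub>k\<^esub>) \<odot>\<^bsub>A\<^esub> \<one>\<^bsub>A\<^esub> \<otimes>\<^bsub>A\<^esub> [p] \<cdot>\<^bsub>A\<^esub> \<one>\<^bsub>A\<^esub>"
      using W by (simp add: pA A.smult_assoc1 A.smult_assoc2)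
    moreover have "ideal (Idl\<^bsub>A\<^esub> {[p] \<cdot>\<^bsub>A\<^esub> \<one>\<^bsub>A\<^esub>}) A" by (rule ring.genideal_ideal[OF rA]) simp
    moreover have "[p] \<cdot>\<^bsub>A\<^esub> \<one>\<^bsub>A\<^esub> \<in> Idl\<^bsub>A\<^esub> {[p] \<cdot>\<^bsub>A\<^esub> \<one>\<^bsub>A\<^esub>}" by (rule ring.genideal_self'[OF rA]) simp
    ultimately show "(a0, a1) \<odot>\<^bsub>A\<^esub> \<one>\<^bsub>A\<^esub> \<in> Idl\<^bsub>A\<^esub> {[p] \<cdot>\<^bsub>A\<^esub> \<one>\<^bsub>A\<^esub>}"
      using W(1) by (simp add: ideal.I_l_closed)
  qed
  have K: "?K \<subseteq> carrier A" by auto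
  show ?thesis unfolding red_ideal_def
  proof (rule equalityI)
    show "Idl\<^bsub>A\<^esub> ?K \<subseteq> Idl\<^bsub>A\<^esub> {[p] \<cdot>\<^bsub>A\<^esub> \<one>\<^bsub>A\<^esub>}"
      by (rule ring.genideal_minimal[OF rA ring.genideal_ideal[OF rA] sub]) simp
    show "Idl\<^bsub>A\<^esub> {[p] \<cdot>\<^bsub>A\<^esub> \<one>\<^bsub>A\<^esub>} \<subseteq> Idl\<^bsub>A\<^esub> ?K"
      by (rule ring.genideal_minimal[OF rA ring.genideal_ideal[OF rA K]])
        (use ring.genideal_self[OF rA K] mem in blast)
  qed
qed

definition red_map :: "('k, 'x) ring_scheme \<Rightarrow> nat \<Rightarrow> ('k \<times> 'k, 'a, 'y) module_scheme \<Rightarrow> 'a \<Rightarrow> 'a set" where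
  "red_map k p A a = red_ideal k p A +>\<^bsub>A\<^esub> a"

definition reduction :: "('k, 'x) ring_scheme \<Rightarrow> nat \<Rightarrow> ('k \<times> 'k, 'a, 'y) module_scheme \<Rightarrow> ('k, 'a set) module" where
  "reduction k p A =
    algebra_via (A Quot red_ideal k p A) (\<lambda>c. red_map k p A ((c, \<zero>\<^bsub>k\<^esub>) \<odot>\<^bsub>A\<^esub> \<one>\<^bsub>A\<^esub>))"


section \<open>Total \<open>p\<close>-differentials\<close>

definition tot_rels :: "('k, 'x) ring_scheme \<Rightarrow> nat \<Rightarrow> ('k \<times> 'k, 'a, 'y) module_scheme \<Rightarrow> ('a \<Rightarrow> 'a set) set" where
  "tot_rels k p A =
    (let A0 = reduction k p A; \<pi> = red_map k p A;
         F = free_module A0 (carrier A); d = free_gen A0; dp = d ([p] \<cdot>\<^bsub>A\<^esub> \<one>\<^bsub>A\<^esub>) in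
      {d (a \<oplus>\<^bsub>A\<^esub> b) \<ominus>\<^bsub>F\<^esub> (d a \<oplus>\<^bsub>F\<^esub> d b \<oplus>\<^bsub>F\<^esub> \<pi> (Cp A p a b) \<odot>\<^bsub>F\<^esub> dp) | a b.
         a \<in> carrier A \<and> b \<in> carrier A} \<union>
      {d (a \<otimes>\<^bsub>A\<^esub> b) \<ominus>\<^bsub>F\<^esub> (\<pi> (b [^]\<^bsub>A\<^esub> p) \<odot>\<^bsub>F\<^esub> d a \<oplus>\<^bsub>F\<^esub> \<pi> (a [^]\<^bsub>A\<^esub> p) \<odot>\<^bsub>F\<^esub> d b) | a b.
         a \<in> carrier A \<and> b \<in> carrier A} \<union>
      {d (r \<odot>\<^bsub>A\<^esub> \<one>\<^bsub>A\<^esub>) \<ominus>\<^bsub>F\<^esub> (witt2_delta p k r \<odot>\<^bsub>A0\<^esub> \<one>\<^bsub>A0\<^esub>) \<odot>\<^bsub>F\<^esub> dp | r.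
         r \<in> carrier (witt2 p k)})"

definition tot_diff ::
    "('k, 'x) ring_scheme \<Rightarrow> nat \<Rightarrow> ('k \<times> 'k, 'a, 'y) module_scheme \<Rightarrow> ('a set, ('a \<Rightarrow> 'a set) set) module"
  where "tot_diff k p A = presented_module (reduction k p A) (carrier A) (tot_rels k p A)"

definition tot_d ::
    "('k, 'x) ring_scheme \<Rightarrow> nat \<Rightarrow> ('k \<times> 'k, 'a, 'y) module_scheme \<Rightarrow> 'a \<Rightarrow> ('a \<Rightarrow> 'a set) set"
  where "tot_d k p A = presented_gen (reduction k p A) (carrier A) (tot_rels k p A)"

end

theory Submission
  imports Defs "HOL-Computational_Algebra.Polynomial"
begin

text \<open>The projection \<open>W\<^sub>2(A\<^sub>0) \<rightarrow> A\<^sub>0\<close> is a surjection of \<open>W\<^sub>2(k)\<close>-algebras whose kernel has square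
  zero, so formal smoothness lifts the reduction map \<open>A \<rightarrow> A\<^sub>0\<close> to a ring homomorphism
  \<open>A \<rightarrow> W\<^sub>2(A\<^sub>0)\<close>. Its second component satisfies the defining relations of the total
  \<open>p\<close>-differential and takes the value \<open>1\<close> at \<open>p\<close>; the induced linear map
  from the total differentials to \<open>A\<^sub>0\<close> is a retraction of \<open>\<alpha>\<close>. Modulo the
  differential of \<open>p\<close>, the relations say that the total differential is a derivation
  along the Frobenius which factors through \<open>A\<^sub>0\<close>, and those are represented by
  \<open>F\<^sup>*\<Omega>\<close>.\<close>

section \<open>Quotients and presentations of modules\<close>

text \<open>The retraction exists because the second components of Witt vectors over a ring with
  \<open>p = 0\<close> compute as \<open>b + d + C_p(a, c)\<close> for a sum
  \<open>(a, b) + (c, d)\<close> and as \<open>a^p d + c^p b\<close> for a product. These are the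
  sum and product relations of the total differential as soon as \<open>d p\<close> is sent to
  \<open>1\<close>, and \<open>1\<close> is the right value since \<open>p = (0, 1)\<close> in
  \<open>W_2(k)\<close>. The relation on constants fits because \<open>(phi(r) - r^p)/p\<close> is
  just the second component of \<open>r\<close>. Smoothness enters only through this retraction. The
  field \<open>k\<close> may be imperfect, so the kernel of \<open>W_2(k) -> k\<close> can be larger
  than the multiples of \<open>p\<close>; the relation on constants still sends each
  \<open>(0, e)\<close> to a multiple of \<open>d p\<close>, which is why the differential modulo
  \<open>d p\<close> descends to \<open>A0\<close>. A second obstacle is formal: the lifting
  property speaks only of test algebras in one fixed type, so \<open>W_2(A0)\<close> has to be
  copied into that type along an injection.\<close>

locale linear_map = M: module R M + N: module R N
  for R :: "('r, 'x) ring_scheme" and M :: "('r, 'm, 'y) module_scheme"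
    and N :: "('r, 'n, 'z) module_scheme" +
  fixes f :: "'m \<Rightarrow> 'n"
  assumes f: "f \<in> mod_hom R M N"
begin

lemma closed [simp, intro]: "x \<in> carrier M \<Longrightarrow> f x \<in> carrier N"
  using f by (auto simp: mod_hom_def)

lemma add [simp]: "x \<in> carrier M \<Longrightarrow> y \<in> carrier M \<Longrightarrow> f (x \<oplus>\<^bsub>M\<^esub> y) = f x \<oplus>\<^bsub>N\<^esub> f y"
  using f by (auto simp: mod_hom_def)

lemma smult [simp]: "r \<in> carrier R \<Longrightarrow> x \<in> carrier M \<Longrightarrow> f (r \<odot>\<^bsub>M\<^esub> x) = r \<odot>\<^bsub>N\<^esub> f x"
  using f by (auto simp: mod_hom_def)

lemma zero [simp]: "f \<zero>\<^bsub>M\<^esub> = \<zero>\<^bsub>N\<^esub>"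
  using smult[of "\<zero>\<^bsub>R\<^esub>" "\<zero>\<^bsub>M\<^esub>"] by simp

lemma a_inv [simp]: "x \<in> carrier M \<Longrightarrow> f (\<ominus>\<^bsub>M\<^esub> x) = \<ominus>\<^bsub>N\<^esub> f x"
  by (metis M.M.add.inv_closed M.M.l_neg N.M.minus_equality add closed zero)

lemma minus [simp]: "x \<in> carrier M \<Longrightarrow> y \<in> carrier M \<Longrightarrow> f (x \<ominus>\<^bsub>M\<^esub> y) = f x \<ominus>\<^bsub>N\<^esub> f y"
  by (simp add: a_minus_def)

lemma submodule_vimage:
  assumes "submodule H R N"
  shows "submodule {x \<in> carrier M. f x \<in> H} R M"
  using subgroup.one_closed[OF submodule.axioms(1)[OF assms]]
  by (intro M.submoduleI) (auto simp: N.submoduleE(3,4,5)[OF assms])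

lemma submodule_image: "submodule (f ` carrier M) R N"
proof (rule N.submoduleI)
  show "\<zero>\<^bsub>N\<^esub> \<in> f ` carrier M" using zero by (metis M.M.zero_closed imageI)
  show "\<ominus>\<^bsub>N\<^esub> a \<in> f ` carrier M" if "a \<in> f ` carrier M" for a
    using that by (force simp flip: a_inv)
  show "a \<oplus>\<^bsub>N\<^esub> b \<in> f ` carrier M" if "a \<in> f ` carrier M" "b \<in> f ` carrier M" for a b
    using that by (force simp flip: add)
  show "a \<odot>\<^bsub>N\<^esub> x \<in> f ` carrier M" if "a \<in> carrier R" "x \<in> f ` carrier M" for a x
    using that by (force simp flip: smult)
qed auto

lemma kernel_eq: "a_kernel M N f = {x \<in> carrier M. f x = \<zero>\<^bsub>N\<^esub>}"
  by (simp add: a_kernel_def kernel_def)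

end

text \<open>Defining relations are differences in a free module; this turns the vanishing of their
  images into equations.\<close>

lemma (in abelian_group) diff_eq_zero_iff:
  assumes "x \<in> carrier G" "y \<in> carrier G" shows "x \<ominus> y = \<zero> \<longleftrightarrow> x = y"
  using assms minus_equality[of x "\<ominus> y"] by (auto simp: a_minus_def r_neg)

lemma (in abelian_group) diff_zero: "x \<in> carrier G \<Longrightarrow> x \<ominus> \<zero> = x"
  using minus_equality[of \<zero> \<zero>] by (simp add: a_minus_def)

lemma (in module) zero_submodule: "submodule {\<zero>\<^bsub>M\<^esub>} R M"
  by (rule submoduleI) auto

lemma mod_hom_comp:
  "f \<in> mod_hom R L M \<Longrightarrow> g \<in> mod_hom R M N \<Longrightarrow> g \<circ> f \<in> mod_hom R L N"
  by (auto simp: mod_hom_def Pi_iff)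

text \<open>The equalizer being a submodule, linear maps that agree on generators agree
  everywhere.\<close>

lemma mod_hom_eq_submodule:
  assumes "linear_map R M N f" "linear_map R M N g"
  shows "submodule {x \<in> carrier M. f x = g x} R M"
proof -
  interpret f: linear_map R M N f by fact
  interpret g: linear_map R M N g by fact
  show ?thesis by (rule f.M.submoduleI) auto
qed

lemma submodule_gen_minimal:
  "submodule H R M \<Longrightarrow> G \<subseteq> H \<Longrightarrow> submodule_gen R M G \<subseteq> H"
  by (auto simp: submodule_gen_def)

lemma submodule_gen_incl: "G \<subseteq> submodule_gen R M G"
  by (auto simp: submodule_gen_def)

context module
begin

lemma submodule_zero: "submodule H R M \<Longrightarrow> \<zero>\<^bsub>M\<^esub> \<in> H"
  using subgroup.one_closed[OF submodule.axioms(1)] by fastforce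

lemma submodule_gen_submodule:
  assumes "G \<subseteq> carrier M"
  shows "submodule (submodule_gen R M G) R M"
proof (rule submoduleI)
  show "submodule_gen R M G \<subseteq> carrier M"
    by (rule submodule_gen_minimal[OF carrier_is_submodule assms])
qed (auto simp: submodule_gen_def submoduleE(3,4,5) submodule_zero)

text \<open>Needed for exactness in the middle: the image of \<open>\<alpha>\<close> consists of the
  multiples of \<open>dtot pA\<close>, while the kernel of \<open>\<beta>\<close> is found as a
  generated submodule.\<close>

lemma submodule_gen_singleton:
  assumes "x \<in> carrier M"
  shows "submodule_gen R M {x} = (\<lambda>r. r \<odot>\<^bsub>M\<^esub> x) ` carrier R"
proof (rule equalityI)
  have "submodule ((\<lambda>r. r \<odot>\<^bsub>M\<^esub> x) ` carrier R) R M"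
  proof (rule submoduleI)
    show "\<zero>\<^bsub>M\<^esub> \<in> (\<lambda>r. r \<odot>\<^bsub>M\<^esub> x) ` carrier R"
      using smult_l_null[OF assms] by (metis R.zero_closed imageI)
  qed (use assms in \<open>auto simp flip: smult_l_distr smult_l_minus smult_assoc1\<close>)
  moreover have "x \<in> (\<lambda>r. r \<odot>\<^bsub>M\<^esub> x) ` carrier R"
    using smult_one[OF assms] by (metis R.one_closed imageI)
  ultimately show "submodule_gen R M {x} \<subseteq> (\<lambda>r. r \<odot>\<^bsub>M\<^esub> x) ` carrier R"
    by (simp add: submodule_gen_minimal)
  show "(\<lambda>r. r \<odot>\<^bsub>M\<^esub> x) ` carrier R \<subseteq> submodule_gen R M {x}"
    using submodule.smult_closed[OF submodule_gen_submodule[of "{x}"]]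
      submodule_gen_incl[of "{x}" R M] assms by auto
qed

end

section \<open>Quotient modules\<close>

locale quotient_module = module R M + H: submodule H R M
  for R :: "('r, 'x) ring_scheme" and M :: "('r, 'm, 'y) module_scheme" and H
begin

lemma abelian_subgroup_H: "abelian_subgroup H M"
  by (rule abelian_subgroupI3)
    (use H.subgroup_axioms in \<open>auto intro: additive_subgroup.intro abelian_group_axioms\<close>)

sublocale H: abelian_subgroup H M
  by (rule abelian_subgroup_H)

lemma coset_eq_iff:
  assumes "x \<in> carrier M" "y \<in> carrier M"
  shows "H +>\<^bsub>M\<^esub> x = H +>\<^bsub>M\<^esub> y \<longleftrightarrow> x \<ominus>\<^bsub>M\<^esub> y \<in> H"
proof -
  have "x \<ominus>\<^bsub>M\<^esub> y \<in> H \<longleftrightarrow> x \<in> H +>\<^bsub>M\<^esub> y"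
    unfolding a_minus_def by (rule H.a_rcos_module[symmetric]) (use assms in simp_all)
  thus ?thesis
    using assms H.a_repr_independence'[of x y] H.a_rcos_self[of x] by blast
qed

text \<open>\<open>quot_module\<close> avoids choosing representatives by taking a union over the
  whole coset. The union collapses to one coset because multiples of elements of \<open>H\<close>
  stay in \<open>H\<close>.\<close>

lemma smult_coset:
  assumes r: "r \<in> carrier R" and x: "x \<in> carrier M"
  shows "(\<Union>y\<in>H +>\<^bsub>M\<^esub> x. H +>\<^bsub>M\<^esub> (r \<odot>\<^bsub>M\<^esub> y)) = H +>\<^bsub>M\<^esub> (r \<odot>\<^bsub>M\<^esub> x)"
proof -
  have "H +>\<^bsub>M\<^esub> (r \<odot>\<^bsub>M\<^esub> y) = H +>\<^bsub>M\<^esub> (r \<odot>\<^bsub>M\<^esub> x)" if y: "y \<in> H +>\<^bsub>M\<^esub> x" for y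
  proof -
    have yM: "y \<in> carrier M" using y x H.a_elemrcos_carrier by blast
    have "y \<ominus>\<^bsub>M\<^esub> x \<in> H" using y yM x H.a_rcos_module by (simp add: a_minus_def)
    hence "r \<odot>\<^bsub>M\<^esub> (y \<ominus>\<^bsub>M\<^esub> x) \<in> H" using r by simp
    moreover have "r \<odot>\<^bsub>M\<^esub> (y \<ominus>\<^bsub>M\<^esub> x) = r \<odot>\<^bsub>M\<^esub> y \<ominus>\<^bsub>M\<^esub> r \<odot>\<^bsub>M\<^esub> x"
      using r x yM by (simp only: a_minus_def smult_r_distr smult_r_minus M.a_inv_closed)
    ultimately show ?thesis using r x yM coset_eq_iff[of "r \<odot>\<^bsub>M\<^esub> y" "r \<odot>\<^bsub>M\<^esub> x"] by simp
  qed
  thus ?thesis using H.a_rcos_self[OF x] by blast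
qed

abbreviation Q where "Q \<equiv> quot_module M H"

lemma carrier_quot: "carrier Q = (\<lambda>x. H +>\<^bsub>M\<^esub> x) ` carrier M"
  by (auto simp: quot_module_def A_RCOSETS_def' )

lemma quot_add:
  "x \<in> carrier M \<Longrightarrow> y \<in> carrier M \<Longrightarrow> (H +>\<^bsub>M\<^esub> x) \<oplus>\<^bsub>Q\<^esub> (H +>\<^bsub>M\<^esub> y) = H +>\<^bsub>M\<^esub> (x \<oplus>\<^bsub>M\<^esub> y)"
  by (simp add: quot_module_def H.a_rcos_sum)

lemma quot_smult:
  "r \<in> carrier R \<Longrightarrow> x \<in> carrier M \<Longrightarrow> r \<odot>\<^bsub>Q\<^esub> (H +>\<^bsub>M\<^esub> x) = H +>\<^bsub>M\<^esub> (r \<odot>\<^bsub>M\<^esub> x)"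
  by (simp add: quot_module_def smult_coset)

lemma quot_zero: "\<zero>\<^bsub>Q\<^esub> = H +>\<^bsub>M\<^esub> \<zero>\<^bsub>M\<^esub>"
  using M.a_coset_add_zero[OF H.a_subset] by (simp add: quot_module_def)

lemma module_quot: "module R Q"
proof (rule moduleI)
  show "abelian_group Q"
  proof (rule abelian_groupI)
    show "\<exists>y\<in>carrier Q. y \<oplus>\<^bsub>Q\<^esub> x = \<zero>\<^bsub>Q\<^esub>" if x: "x \<in> carrier Q" for x
    proof -
      obtain m where m: "x = H +>\<^bsub>M\<^esub> m" "m \<in> carrier M"
        using x[unfolded carrier_quot] by (rule imageE)
      show ?thesis
        by (rule bexI[of _ "H +>\<^bsub>M\<^esub> (\<ominus>\<^bsub>M\<^esub> m)"])
          (use m in \<open>auto simp: carrier_quot quot_add quot_zero M.l_neg\<close>)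
    qed
  qed (auto simp: carrier_quot quot_add quot_zero M.a_ac)
qed (auto simp: carrier_quot quot_add quot_smult smult_l_distr smult_r_distr smult_assoc1
  intro: R.is_cring)

lemma proj_linear: "linear_map R M Q (\<lambda>x. H +>\<^bsub>M\<^esub> x)"
  by (intro linear_map.intro linear_map_axioms.intro module_quot module_axioms)
    (auto simp: mod_hom_def carrier_quot quot_add quot_smult intro: module.intro
      cring.axioms R.cring_axioms M.abelian_group_axioms module_axioms)

lemma proj_eq_zero_iff: "x \<in> carrier M \<Longrightarrow> H +>\<^bsub>M\<^esub> x = \<zero>\<^bsub>Q\<^esub> \<longleftrightarrow> x \<in> H"
  by (simp only: quot_zero coset_eq_iff M.zero_closed M.diff_zero)

lemma quot_desc:
  assumes "linear_map R M N f" and ker: "\<And>x. x \<in> H \<Longrightarrow> f x = \<zero>\<^bsub>N\<^esub>"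
  shows "\<exists>g\<in>mod_hom R Q N. \<forall>x\<in>carrier M. g (H +>\<^bsub>M\<^esub> x) = f x"
proof -
  interpret f: linear_map R M N f by fact
  \<comment> \<open>The choice of representative is harmless: two of them differ by an element of
    \<open>H\<close>, which \<open>f\<close> kills.\<close>
  define g where "g C = f (SOME x. x \<in> carrier M \<and> C = H +>\<^bsub>M\<^esub> x)" for C
  have g: "g (H +>\<^bsub>M\<^esub> x) = f x" if x: "x \<in> carrier M" for x
  proof -
    define y where "y = (SOME y. y \<in> carrier M \<and> H +>\<^bsub>M\<^esub> x = H +>\<^bsub>M\<^esub> y)"
    have y: "y \<in> carrier M \<and> H +>\<^bsub>M\<^esub> x = H +>\<^bsub>M\<^esub> y"
      unfolding y_def by (rule someI[of _ x]) (use x in simp)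
    hence "f (x \<ominus>\<^bsub>M\<^esub> y) = \<zero>\<^bsub>N\<^esub>" using x ker coset_eq_iff by blast
    hence "f x = f y" using x y by (simp add: f.N.M.diff_eq_zero_iff)
    thus ?thesis by (simp add: g_def y_def)
  qed
  thus ?thesis
    by (intro bexI[of _ g]) (auto simp: mod_hom_def carrier_quot quot_add quot_smult)
qed

end

section \<open>Free modules as finitely supported functions\<close>

context cring
begin

abbreviation support where "support f \<equiv> {s. f s \<noteq> \<zero>}"

lemma free_module_simps [simp]:
  "\<zero>\<^bsub>free_module R S\<^esub> = (\<lambda>s. \<zero>)"
  "f \<oplus>\<^bsub>free_module R S\<^esub> g = (\<lambda>s. f s \<oplus> g s)"
  "r \<odot>\<^bsub>free_module R S\<^esub> f = (\<lambda>s. r \<otimes> f s)"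
  by (simp_all add: free_module_def)

lemma free_moduleI:
  "(\<And>s. s \<in> S \<Longrightarrow> f s \<in> carrier R) \<Longrightarrow> support f \<subseteq> S \<Longrightarrow> finite (support f) \<Longrightarrow>
    f \<in> carrier (free_module R S)"
  by (auto simp: free_module_def)

lemma
  assumes "f \<in> carrier (free_module R S)"
  shows free_module_closed: "f s \<in> carrier R"
    and free_module_support: "support f \<subseteq> S"
    and free_module_finite: "finite (support f)"
  using assms by (cases "s \<in> S"; auto simp: free_module_def)+

lemma free_module_module: "module R (free_module R S)"
proof (rule moduleI)
  show "abelian_group (free_module R S)"
  proof (rule abelian_groupI)
    fix f g assume fg: "f \<in> carrier (free_module R S)" "g \<in> carrier (free_module R S)"
    have "support (\<lambda>s. f s \<oplus> g s) \<subseteq> support f \<union> support g" by auto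
    moreover have "support f \<union> support g \<subseteq> S" "finite (support f \<union> support g)"
      using fg free_module_support free_module_finite by blast+
    ultimately show "f \<oplus>\<^bsub>free_module R S\<^esub> g \<in> carrier (free_module R S)"
      unfolding free_module_simps
      by (intro free_moduleI a_closed free_module_closed[OF fg(1)] free_module_closed[OF fg(2)])
        (blast intro: finite_subset)+
  next
    fix f assume f: "f \<in> carrier (free_module R S)"
    hence c: "f s \<in> carrier R" for s by (rule free_module_closed)
    have "support (\<lambda>s. \<ominus> f s) \<subseteq> support f" by auto
    hence "(\<lambda>s. \<ominus> f s) \<in> carrier (free_module R S)"
      using free_module_support[OF f] free_module_finite[OF f]
      by (intro free_moduleI a_inv_closed c) (blast intro: finite_subset)+
    thus "\<exists>g\<in>carrier (free_module R S). g \<oplus>\<^bsub>free_module R S\<^esub> f = \<zero>\<^bsub>free_module R S\<^esub>"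
      by (rule bexI[rotated]) (simp add: l_neg c)
  next
    fix f g h
    assume "f \<in> carrier (free_module R S)" "g \<in> carrier (free_module R S)" "h \<in> carrier (free_module R S)"
    from this[THEN free_module_closed]
    show "f \<oplus>\<^bsub>free_module R S\<^esub> g \<oplus>\<^bsub>free_module R S\<^esub> h =
      f \<oplus>\<^bsub>free_module R S\<^esub> (g \<oplus>\<^bsub>free_module R S\<^esub> h)" by (simp add: a_assoc)
  next
    fix f g
    assume "f \<in> carrier (free_module R S)" "g \<in> carrier (free_module R S)"
    from this[THEN free_module_closed]
    show "f \<oplus>\<^bsub>free_module R S\<^esub> g = g \<oplus>\<^bsub>free_module R S\<^esub> f" by (simp add: a_comm)
  next
    fix f
    assume "f \<in> carrier (free_module R S)"
    from this[THEN free_module_closed]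
    show "\<zero>\<^bsub>free_module R S\<^esub> \<oplus>\<^bsub>free_module R S\<^esub> f = f" by simp
  qed (auto intro: free_moduleI)
next
  fix r f assume rf: "r \<in> carrier R" "f \<in> carrier (free_module R S)"
  have "support (\<lambda>s. r \<otimes> f s) \<subseteq> support f" using rf(1) by auto
  thus "r \<odot>\<^bsub>free_module R S\<^esub> f \<in> carrier (free_module R S)"
    unfolding free_module_simps
    using free_module_support[OF rf(2)] free_module_finite[OF rf(2)]
    by (intro free_moduleI m_closed rf(1) free_module_closed[OF rf(2)]) (blast intro: finite_subset)+
next
  fix a b f assume ab: "a \<in> carrier R" "b \<in> carrier R" and "f \<in> carrier (free_module R S)"
  from this(3)[THEN free_module_closed] ab
  show "(a \<oplus> b) \<odot>\<^bsub>free_module R S\<^esub> f =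
      a \<odot>\<^bsub>free_module R S\<^esub> f \<oplus>\<^bsub>free_module R S\<^esub> b \<odot>\<^bsub>free_module R S\<^esub> f"
    "(a \<otimes> b) \<odot>\<^bsub>free_module R S\<^esub> f = a \<odot>\<^bsub>free_module R S\<^esub> (b \<odot>\<^bsub>free_module R S\<^esub> f)"
    by (simp_all add: l_distr m_assoc)
next
  fix a f g assume a: "a \<in> carrier R"
    and "f \<in> carrier (free_module R S)" "g \<in> carrier (free_module R S)"
  from this(2,3)[THEN free_module_closed] a
  show "a \<odot>\<^bsub>free_module R S\<^esub> (f \<oplus>\<^bsub>free_module R S\<^esub> g) =
      a \<odot>\<^bsub>free_module R S\<^esub> f \<oplus>\<^bsub>free_module R S\<^esub> a \<odot>\<^bsub>free_module R S\<^esub> g"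
    by (simp add: r_distr)
next
  fix f assume "f \<in> carrier (free_module R S)"
  from this[THEN free_module_closed] show "\<one> \<odot>\<^bsub>free_module R S\<^esub> f = f" by simp
qed (rule is_cring)

lemma free_gen_closed: "s \<in> S \<Longrightarrow> free_gen R s \<in> carrier (free_module R S)"
  by (rule free_moduleI) (auto simp: free_gen_def)

text \<open>An element is a finite combination of basis vectors. The induction runs over a finite
  set containing the support and splits off the coefficient at one index at a time.\<close>

lemma free_module_generated:
  assumes H: "submodule H R (free_module R S)" and gen: "\<And>s. s \<in> S \<Longrightarrow> free_gen R s \<in> H"
  shows "carrier (free_module R S) \<subseteq> H"
proof
  let ?F = "free_module R S"
  interpret F: module R ?F by (rule free_module_module)
  have "f \<in> H" if "finite T" "f \<in> carrier ?F" "support f \<subseteq> T" for T f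
    using that
  proof (induction T arbitrary: f rule: finite_induct)
    case empty
    hence "f = \<zero>\<^bsub>?F\<^esub>" by (auto simp: fun_eq_iff)
    thus ?case using subgroup.one_closed[OF submodule.axioms(1)[OF H]] by simp
  next
    case (insert t T)
    show ?case
    proof (cases "t \<in> S")
      case False
      hence "support f \<subseteq> T" using insert.prems(2) free_module_support[OF insert.prems(1)] by blast
      thus ?thesis using insert by blast
    next
      case True
      define g where "g = (\<lambda>s. if s = t then \<zero> else f s)"
      have c: "f s \<in> carrier R" for s using insert.prems(1) by (rule free_module_closed)
      have "support g \<subseteq> T" "support g \<subseteq> S"
        using insert.prems(2) free_module_support[OF insert.prems(1)] by (auto simp: g_def)
      moreover have "g s \<in> carrier R" for s using c by (simp add: g_def)
      ultimately have "g \<in> H"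
        by (intro insert.IH free_moduleI) (blast intro: finite_subset[OF _ insert.hyps(1)])+
      moreover have "f t \<odot>\<^bsub>?F\<^esub> free_gen R t \<in> H"
        by (rule submodule.smult_closed[OF H c gen[OF True]])
      ultimately have "g \<oplus>\<^bsub>?F\<^esub> f t \<odot>\<^bsub>?F\<^esub> free_gen R t \<in> H" by (rule F.submoduleE(5)[OF H])
      moreover have "g \<oplus>\<^bsub>?F\<^esub> f t \<odot>\<^bsub>?F\<^esub> free_gen R t = f"
        using c by (auto simp: g_def free_gen_def fun_eq_iff)
      ultimately show ?thesis by simp
    qed
  qed
  thus "f \<in> H" if "f \<in> carrier ?F" for f using that free_module_finite by blast
qed

lemma free_module_hom:
  fixes N :: "('a, 'n, 'z) module_scheme"
  assumes N: "module R N" and d: "\<And>s. s \<in> S \<Longrightarrow> d s \<in> carrier N"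
  shows "\<exists>f. linear_map R (free_module R S) N f \<and> (\<forall>s\<in>S. f (free_gen R s) = d s)"
proof -
  let ?F = "free_module R S"
  interpret F: module R ?F by (rule free_module_module)
  interpret N: module R N by (rule N)
  define h where "h f = finsum N (\<lambda>s. f s \<odot>\<^bsub>N\<^esub> d s) (support f)" for f
  have supp: "s \<in> S" if "f \<in> carrier ?F" "f s \<noteq> \<zero>" for f s
    using that free_module_support by blast
  \<comment> \<open>Summing over any finite \<open>T\<close> that contains the support gives
    \<open>f\<close>, \<open>g\<close> and their sum a common index set; the support of the sum may
    be smaller because of cancellation.\<close>
  have h: "h f = finsum N (\<lambda>s. f s \<odot>\<^bsub>N\<^esub> d s) T"
    if "f \<in> carrier ?F" "finite T" "support f \<subseteq> T" "T \<subseteq> S" for f T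
    unfolding h_def by (rule N.add.finprod_mono_neutral_cong_left)
      (use that d free_module_closed[OF that(1)] in \<open>auto simp: subset_iff\<close>)
  have "h \<in> mod_hom R ?F N"
    unfolding mod_hom_def
  proof (intro CollectI conjI ballI)
    show "h \<in> carrier ?F \<rightarrow> carrier N"
      unfolding h_def using supp d
      by (intro Pi_I N.finsum_closed N.smult_closed) (auto intro: free_module_closed)
  next
    fix f g assume f: "f \<in> carrier ?F" and g: "g \<in> carrier ?F"
    let ?T = "support f \<union> support g"
    have fg: "f \<oplus>\<^bsub>?F\<^esub> g \<in> carrier ?F" using f g by (rule F.M.a_closed)
    have T: "finite ?T" "?T \<subseteq> S" using f g free_module_support free_module_finite by blast+
    have c: "f s \<in> carrier R" "g s \<in> carrier R" for s using f g by (auto intro: free_module_closed)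
    have fgs: "support (\<lambda>s. f s \<oplus> g s) \<subseteq> ?T" by auto
    have "h (f \<oplus>\<^bsub>?F\<^esub> g) = finsum N (\<lambda>s. (f s \<oplus> g s) \<odot>\<^bsub>N\<^esub> d s) ?T"
      using h[OF fg T(1) _ T(2)] fgs by simp
    also have "\<dots> = finsum N (\<lambda>s. f s \<odot>\<^bsub>N\<^esub> d s \<oplus>\<^bsub>N\<^esub> g s \<odot>\<^bsub>N\<^esub> d s) ?T"
      by (rule N.finsum_cong')
        (use T d c in \<open>auto intro!: N.smult_l_distr\<close>)
    also have "\<dots> = finsum N (\<lambda>s. f s \<odot>\<^bsub>N\<^esub> d s) ?T \<oplus>\<^bsub>N\<^esub> finsum N (\<lambda>s. g s \<odot>\<^bsub>N\<^esub> d s) ?T"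
      by (rule N.finsum_addf)
        (use T d c in auto)
    also have "\<dots> = h f \<oplus>\<^bsub>N\<^esub> h g"
      using h[OF f T(1) _ T(2)] h[OF g T(1) _ T(2)] by simp
    finally show "h (f \<oplus>\<^bsub>?F\<^esub> g) = h f \<oplus>\<^bsub>N\<^esub> h g" .
  next
    fix r f assume r: "r \<in> carrier R" and f: "f \<in> carrier ?F"
    let ?T = "support f"
    have rf: "r \<odot>\<^bsub>?F\<^esub> f \<in> carrier ?F" using r f by (rule F.smult_closed)
    have T: "finite ?T" "?T \<subseteq> S" using f free_module_support free_module_finite by blast+
    have c: "f s \<in> carrier R" for s using f by (rule free_module_closed)
    have rfs: "support (\<lambda>s. r \<otimes> f s) \<subseteq> ?T" using r by auto
    have "h (r \<odot>\<^bsub>?F\<^esub> f) = finsum N (\<lambda>s. (r \<otimes> f s) \<odot>\<^bsub>N\<^esub> d s) ?T"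
      using h[OF rf T(1) _ T(2)] rfs by simp
    also have "\<dots> = finsum N (\<lambda>s. r \<odot>\<^bsub>N\<^esub> (f s \<odot>\<^bsub>N\<^esub> d s)) ?T"
      by (rule N.finsum_cong')
        (use T d c r in \<open>auto intro!: N.smult_assoc1\<close>)
    also have "\<dots> = r \<odot>\<^bsub>N\<^esub> h f" unfolding h_def
      by (rule N.finsum_smult_ldistr[symmetric])
        (use T d c r in auto)
    finally show "h (r \<odot>\<^bsub>?F\<^esub> f) = r \<odot>\<^bsub>N\<^esub> h f" .
  qed
  hence "linear_map R ?F N h"
    by (intro linear_map.intro linear_map_axioms.intro F.module_axioms N.module_axioms
      free_module_module N)
  moreover have "h (free_gen R s) = d s" if s: "s \<in> S" for s
  proof -
    have "h (free_gen R s) = finsum N (\<lambda>t. free_gen R s t \<odot>\<^bsub>N\<^esub> d t) {s}"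
      by (rule h) (use s free_gen_closed in \<open>auto simp: free_gen_def\<close>)
    also have "\<dots> = d s" using d[OF s] by (simp add: free_gen_def)
    finally show ?thesis .
  qed
  ultimately show ?thesis by blast
qed

end

text \<open>From here on relations are pushed through linear maps, whose rules match only while the
  operations of the free module are not unfolded pointwise.\<close>

declare (in cring) free_module_simps [simp del]

section \<open>Modules given by generators and relations\<close>

locale presentation = cring R for R :: "('r, 'x) ring_scheme" and S :: "'s set" and Rel +
  assumes rel_closed: "Rel \<subseteq> carrier (free_module R S)"
begin

abbreviation "F \<equiv> free_module R S"
abbreviation "P \<equiv> presented_module R S Rel"
abbreviation "gen \<equiv> presented_gen R S Rel"

sublocale quotient_module R F "submodule_gen R F Rel"
  by (intro quotient_module.intro free_module_module module.submodule_gen_submodule rel_closed)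

lemma P_module: "module R P"
  using module_quot by (simp add: presented_module_def)

lemma proj: "linear_map R F P (\<lambda>x. submodule_gen R F Rel +>\<^bsub>F\<^esub> x)"
  using proj_linear by (simp add: presented_module_def)

lemma gen_closed: "s \<in> S \<Longrightarrow> gen s \<in> carrier P"
  unfolding presented_gen_def by (rule linear_map.closed[OF proj free_gen_closed])

text \<open>The projection is handed out as an opaque linear map. Each concrete module below applies
  it to a defining relation and reads off an identity between generators.\<close>

lemma rel_proj: "\<exists>q. linear_map R F P q \<and> (\<forall>s\<in>S. q (free_gen R s) = gen s) \<and> (\<forall>\<rho>\<in>Rel. q \<rho> = \<zero>\<^bsub>P\<^esub>)"
proof (intro exI conjI ballI)
  show "linear_map R F P (\<lambda>x. submodule_gen R F Rel +>\<^bsub>F\<^esub> x)" by (rule proj)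
  fix \<rho> assume \<rho>: "\<rho> \<in> Rel"
  hence "\<rho> \<in> submodule_gen R F Rel" "\<rho> \<in> carrier F"
    using submodule_gen_incl[of Rel] rel_closed by auto
  thus "submodule_gen R F Rel +>\<^bsub>F\<^esub> \<rho> = \<zero>\<^bsub>P\<^esub>"
    unfolding presented_module_def by (subst proj_eq_zero_iff)
qed (simp add: presented_gen_def)

lemma generated:
  assumes H: "submodule H R P" and gen: "\<And>s. s \<in> S \<Longrightarrow> gen s \<in> H"
  shows "carrier P \<subseteq> H"
proof
  fix x assume "x \<in> carrier P"
  then obtain f where f: "f \<in> carrier F" "x = submodule_gen R F Rel +>\<^bsub>F\<^esub> f"
    unfolding presented_module_def carrier_quot by blast
  interpret q: linear_map R F P "\<lambda>x. submodule_gen R F Rel +>\<^bsub>F\<^esub> x" by (rule proj)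
  have "carrier F \<subseteq> {x \<in> carrier F. submodule_gen R F Rel +>\<^bsub>F\<^esub> x \<in> H}"
    by (rule free_module_generated[OF q.submodule_vimage[OF H]])
      (use gen free_gen_closed in \<open>auto simp: presented_gen_def\<close>)
  thus "x \<in> H" using f by blast
qed

text \<open>The relations are tested against an arbitrary linear extension of \<open>d\<close>, so
  that they can be verified by linearity alone, without seeing the sum that defines the
  extension.\<close>

lemma univ:
  fixes N :: "('r, 'n, 'z) module_scheme"
  assumes N: "module R N" and d: "\<And>s. s \<in> S \<Longrightarrow> d s \<in> carrier N"
    and rel: "\<And>f \<rho>. linear_map R F N f \<Longrightarrow> (\<And>s. s \<in> S \<Longrightarrow> f (free_gen R s) = d s) \<Longrightarrow> \<rho> \<in> Rel \<Longrightarrow>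
      f \<rho> = \<zero>\<^bsub>N\<^esub>"
  shows "\<exists>g. linear_map R P N g \<and> (\<forall>s\<in>S. g (gen s) = d s)"
proof -
  obtain f where "linear_map R F N f \<and> (\<forall>s\<in>S. f (free_gen R s) = d s)"
    using free_module_hom[of N S d, OF N d] ..
  hence f: "linear_map R F N f" "\<And>s. s \<in> S \<Longrightarrow> f (free_gen R s) = d s" by auto
  interpret f: linear_map R F N f by (rule f)
  have "Rel \<subseteq> {x \<in> carrier F. f x \<in> {\<zero>\<^bsub>N\<^esub>}}" using rel[OF f] rel_closed by auto
  hence "submodule_gen R F Rel \<subseteq> {x \<in> carrier F. f x \<in> {\<zero>\<^bsub>N\<^esub>}}"
    by (intro submodule_gen_minimal f.submodule_vimage f.N.zero_submodule)
  then obtain g where g: "g \<in> mod_hom R Q N" "\<And>x. x \<in> carrier F \<Longrightarrow> g (submodule_gen R F Rel +>\<^bsub>F\<^esub> x) = f x"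
    using quot_desc[OF f(1)] by blast
  have "linear_map R P N g"
    using g(1) P_module N by (simp add: linear_map_def linear_map_axioms_def presented_module_def)
  moreover have "g (gen s) = d s" if "s \<in> S" for s
    unfolding presented_gen_def using g(2)[OF free_gen_closed] f(2) that by simp
  ultimately show ?thesis by blast
qed

end


section \<open>Polynomial identities in arbitrary commutative rings\<close>

text \<open>A bridge from type-class rings, which offer polynomial types and cancellation, to rings
  with a carrier.\<close>

locale eval_hom = cring R for R (structure) +
  fixes h :: "'c::comm_ring_1 \<Rightarrow> 'a"
  assumes h_closed [simp, intro]: "h x \<in> carrier R"
    and h_one [simp]: "h 1 = \<one>"
    and h_add [simp]: "h (x + y) = h x \<oplus> h y"
    and h_mult [simp]: "h (x * y) = h x \<otimes> h y"
begin

lemma h_zero [simp]: "h 0 = \<zero>"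
  using h_add[of 0 0] by (metis add.r_cancel_one' add_0 h_closed)

lemma h_uminus [simp]: "h (- x) = \<ominus> h x"
  using h_add[of "- x" x] minus_equality[of "h (- x)" "h x"] by simp

lemma h_power [simp]: "h (x ^ n) = h x [^] n"
  by (induction n) (simp_all add: m_comm)

lemma h_sum [simp]: "h (\<Sum>i\<in>I. f i) = (\<Oplus>i\<in>I. h (f i))"
proof (cases "finite I")
  case True
  thus ?thesis by (induction I rule: finite_induct) (simp_all add: Pi_iff)
qed (simp add: finsum_infinite)

lemma h_of_nat_mult [simp]: "h (of_nat n * x) = [n] \<cdot> h x"
  by (induction n) (simp_all add: distrib_right a_comm del: h_mult)

text \<open>Horner's scheme: the extension of \<open>h\<close> to one more variable, which is sent
  to \<open>x\<close>.\<close>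

definition poly_eval :: "'a \<Rightarrow> 'c poly \<Rightarrow> 'a" where
  "poly_eval x q = foldr (\<lambda>c r. h c \<oplus> x \<otimes> r) (coeffs q) \<zero>"

lemma poly_eval_hom:
  assumes x: "x \<in> carrier R"
  shows "eval_hom R (poly_eval x)" "poly_eval x (pCons 0 1) = x" "poly_eval x [:c:] = h c"
proof -
  let ?e = "poly_eval x"
  have zero: "?e 0 = \<zero>" by (simp add: poly_eval_def)
  have closed: "?e q \<in> carrier R" for q
  proof -
    have "foldr (\<lambda>c r. h c \<oplus> x \<otimes> r) cs \<zero> \<in> carrier R" for cs
      by (induction cs) (simp_all add: x)
    thus ?thesis by (simp add: poly_eval_def)
  qed
  \<comment> \<open>The zero polynomial is a separate case, since its coefficient list is empty
    rather than a list containing a zero.\<close>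
  have e_pCons: "?e (pCons a q) = h a \<oplus> x \<otimes> ?e q" for a q
    using x closed[of q] by (cases "a = 0 \<and> q = 0") (auto simp: poly_eval_def cCons_def)
  show const: "?e [:c:] = h c" for c using x by (simp add: e_pCons zero)
  show "?e (pCons 0 1) = x" using x const[of 1] by (simp add: e_pCons one_pCons)
  have add: "?e (q + r) = ?e q \<oplus> ?e r" for q r
  proof (induction q r rule: poly_induct2)
    case (pCons a q b r)
    show ?case using x closed[of q] closed[of r] pCons
      by (simp add: e_pCons r_distr a_ac)
  qed (simp add: zero)
  have smult: "?e (Polynomial.smult a q) = h a \<otimes> ?e q" for a q
    by (induction q) (use x closed in \<open>auto simp: zero e_pCons r_distr m_ac\<close>)
  have mult: "?e (q * r) = ?e q \<otimes> ?e r" for q r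
  proof (induction q)
    case (pCons a q)
    have "?e (pCons a q * r) = h a \<otimes> ?e r \<oplus> x \<otimes> ?e (q * r)"
      using x closed by (simp add: add smult e_pCons)
    thus ?case using x closed[of q] closed[of r] pCons.IH
      by (simp add: e_pCons l_distr m_assoc)
  qed (use closed in \<open>simp add: zero\<close>)
  show "eval_hom R ?e"
    using closed const[of 1] add mult by unfold_locales (simp_all add: one_pCons)
qed

end

lemma (in cring) int_eval_hom: "eval_hom R (\<lambda>n::int. [n] \<cdot> \<one>)"
proof (unfold_locales)
  fix m n :: int
  have "([m] \<cdot> \<one>) \<otimes> ([n] \<cdot> \<one>) = [m] \<cdot> ([n] \<cdot> \<one>)"
    using add_pow_ldistr_int[of \<one> "[n] \<cdot> \<one>" m] by simp
  thus "[(m * n)] \<cdot> \<one> = ([m] \<cdot> \<one>) \<otimes> ([n] \<cdot> \<one>)"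
    using add.int_pow_pow[of \<one> m n] by (simp add: mult.commute)
qed (simp_all add: add.int_pow_mult)

text \<open>One evaluation per variable. It may stay unsaid that \<open>u\<close>, \<open>v\<close>,
  \<open>w\<close> come from the variables, because the identities to be transported are proved for
  all elements of the domain.\<close>

lemma (in cring) ex_eval_hom:
  assumes xyz: "x \<in> carrier R" "y \<in> carrier R" "z \<in> carrier R"
  shows "\<exists>(h :: int poly poly poly \<Rightarrow> 'a) u v w. eval_hom R h \<and> h u = x \<and> h v = y \<and> h w = z"
proof -
  interpret h0: eval_hom R "\<lambda>n::int. [n] \<cdot> \<one>" by (rule int_eval_hom)
  note h1 = h0.poly_eval_hom[OF xyz(1)]
  interpret h1: eval_hom R "h0.poly_eval x" by (rule h1)
  note h2 = h1.poly_eval_hom[OF xyz(2)]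
  interpret h2: eval_hom R "h1.poly_eval y" by (rule h2)
  note h3 = h2.poly_eval_hom[OF xyz(3)]
  show ?thesis using h1(2) h2(2,3) h3 by metis
qed


section \<open>The ring of Witt vectors of length two\<close>

text \<open>The identities between values of \<open>C\<^sub>p\<close> that make \<open>W\<^sub>2(R)\<close> a ring become evident after
  multiplication by \<open>p\<close>. They are therefore proved in \<open>\<int>[X][Y][Z]\<close>, where \<open>p\<close> can be cancelled,
  and specialised from there.\<close>

definition Cp_class :: "nat \<Rightarrow> 'c::comm_ring_1 \<Rightarrow> 'c \<Rightarrow> 'c" where
  "Cp_class p x y = - (\<Sum>i\<in>{1..<p}. of_nat ((p choose i) div p) * (x ^ i * y ^ (p - i)))"

lemma Cp_class:
  assumes "Factorial_Ring.prime p"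
  shows "of_nat p * Cp_class p x y = x ^ p + y ^ p - (x + y) ^ p"
  using sum_choose_div_prime[OF assms, of x y] by (simp add: Cp_class_def)

text \<open>In this order the identities yield commutativity of Witt vector addition,
  distributivity, associativity and the neutral element. The third is a cocycle condition:
  \<open>p\<close> times either side is \<open>x^p + y^p + z^p - (x + y + z)^p\<close>.\<close>

lemma Cp_class_identities:
  fixes x y z :: "'c::{idom, ring_char_0}"
  assumes p: "Factorial_Ring.prime p"
  shows "Cp_class p x y = Cp_class p y x"
    and "Cp_class p (z * x) (z * y) = z ^ p * Cp_class p x y"
    and "Cp_class p x y + Cp_class p (x + y) z = Cp_class p y z + Cp_class p x (y + z)"
    and "Cp_class p 0 x = 0"
proof -
  have c: "of_nat p * a = of_nat p * b \<Longrightarrow> a = b" for a b :: 'c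
    using prime_gt_0_nat[OF p] by simp
  note p0 = prime_gt_0_nat[OF p]
  show "Cp_class p x y = Cp_class p y x"
    by (rule c) (simp add: Cp_class[OF p] add.commute)
  show "Cp_class p (z * x) (z * y) = z ^ p * Cp_class p x y"
  proof (rule c)
    have "of_nat p * Cp_class p (z * x) (z * y) = z ^ p * (of_nat p * Cp_class p x y)"
      by (simp only: Cp_class[OF p] power_mult_distrib flip: distrib_left right_diff_distrib)
    thus "of_nat p * Cp_class p (z * x) (z * y) = of_nat p * (z ^ p * Cp_class p x y)"
      by (simp only: mult.left_commute)
  qed
  show "Cp_class p x y + Cp_class p (x + y) z = Cp_class p y z + Cp_class p x (y + z)"
    by (rule c) (simp add: Cp_class[OF p] distrib_left add.assoc)
  show "Cp_class p 0 x = 0"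
    by (rule c) (use p0 in \<open>simp add: Cp_class[OF p]\<close>)
qed

context cring
begin

lemma Cp_closed [simp]:
  assumes "x \<in> carrier R" "y \<in> carrier R" shows "Cp R p x y \<in> carrier R"
  unfolding Cp_def using assms by (intro a_inv_closed finsum_closed) auto

lemma eval_hom_Cp: "eval_hom R h \<Longrightarrow> h (Cp_class p x y) = Cp R p (h x) (h y)"
  unfolding Cp_class_def Cp_def
  by (simp add: eval_hom.h_uminus eval_hom.h_sum eval_hom.h_of_nat_mult eval_hom.h_mult
    eval_hom.h_power)

lemma Cp_comm:
  assumes "Factorial_Ring.prime p" "x \<in> carrier R" "y \<in> carrier R"
  shows "Cp R p x y = Cp R p y x"
proof -
  obtain h :: "int poly poly poly \<Rightarrow> 'a" and u v where "eval_hom R h" "h u = x" "h v = y"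
    using ex_eval_hom[OF assms(2,3) zero_closed] by blast
  thus ?thesis using eval_hom_Cp[of h] Cp_class_identities(1)[OF assms(1), of u v] by metis
qed

lemma Cp_zero:
  assumes "Factorial_Ring.prime p" "x \<in> carrier R"
  shows "Cp R p \<zero> x = \<zero>"
proof -
  obtain h :: "int poly poly poly \<Rightarrow> 'a" and u where h: "eval_hom R h" "h u = x"
    using ex_eval_hom[OF assms(2) zero_closed zero_closed] by blast
  thus ?thesis using eval_hom_Cp[OF h(1), of p 0 u] Cp_class_identities(4)[OF assms(1), of u]
    by (simp add: eval_hom.h_zero)
qed

text \<open>The third identity is the defining equation of \<open>C_p\<close> without subtraction or
  division. Where \<open>p = 0\<close>, its first term vanishes and it becomes additivity of the
  Frobenius.\<close>

lemma Cp_identities: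
  assumes p: "Factorial_Ring.prime p"
    and xyz: "x \<in> carrier R" "y \<in> carrier R" "z \<in> carrier R"
  shows "Cp R p (z \<otimes> x) (z \<otimes> y) = z [^] p \<otimes> Cp R p x y"
    and "Cp R p x y \<oplus> Cp R p (x \<oplus> y) z = Cp R p y z \<oplus> Cp R p x (y \<oplus> z)"
    and "[p] \<cdot> Cp R p x y \<oplus> (x \<oplus> y) [^] p = x [^] p \<oplus> y [^] p"
proof -
  obtain h :: "int poly poly poly \<Rightarrow> 'a" and u v w
    where h: "eval_hom R h" and uvw: "h u = x" "h v = y" "h w = z"
    using ex_eval_hom[OF xyz] by blast
  interpret h: eval_hom R h by (rule h)
  note C = eval_hom_Cp[OF h, of p]
  show "Cp R p (z \<otimes> x) (z \<otimes> y) = z [^] p \<otimes> Cp R p x y"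
    using arg_cong[OF Cp_class_identities(2)[OF p, of w u v], of h] by (simp add: C uvw)
  show "Cp R p x y \<oplus> Cp R p (x \<oplus> y) z = Cp R p y z \<oplus> Cp R p x (y \<oplus> z)"
    using arg_cong[OF Cp_class_identities(3)[OF p, of u v w], of h] by (simp add: C uvw)
  have "of_nat p * Cp_class p u v + (u + v) ^ p = u ^ p + v ^ p"
    by (simp add: Cp_class[OF p])
  from arg_cong[OF this, of h]
  show "[p] \<cdot> Cp R p x y \<oplus> (x \<oplus> y) [^] p = x [^] p \<oplus> y [^] p" by (simp add: C uvw del: h.h_mult)
qed

end

text \<open>The assumption is \<open>p = 0\<close> rather than \<open>has_char\<close>, because the
  locale is also applied to \<open>A0\<close>, which can be the zero ring.\<close>

locale char_p_ring = cring R for R (structure) +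
  fixes p :: nat
  assumes p: "Factorial_Ring.prime p" and p_one: "[p] \<cdot> \<one> = \<zero>"
begin

lemma p_mult [simp]: "x \<in> carrier R \<Longrightarrow> [p] \<cdot> x = \<zero>"
  using add_pow_ldistr[of \<one> x p] p_one by simp

lemma frob_add:
  assumes "x \<in> carrier R" "y \<in> carrier R"
  shows "(x \<oplus> y) [^] p = x [^] p \<oplus> y [^] p"
  using Cp_identities(3)[OF p assms(1,2) zero_closed] assms by simp

lemma frob_zero [simp]: "\<zero> [^] p = \<zero>"
  using prime_gt_0_nat[OF p] by (simp add: nat_pow_zero)

lemma frob_hom: "(\<lambda>x. x [^] p) \<in> ring_hom R R"
  by (rule ring_hom_memI) (auto simp: frob_add nat_pow_distrib)

abbreviation "W \<equiv> witt2 p R"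

lemma witt2_simps [simp]:
  "carrier W = carrier R \<times> carrier R"
  "\<one>\<^bsub>W\<^esub> = (\<one>, \<zero>)" "\<zero>\<^bsub>W\<^esub> = (\<zero>, \<zero>)"
  "(a, b) \<oplus>\<^bsub>W\<^esub> (c, d) = (a \<oplus> c, b \<oplus> d \<oplus> Cp R p a c)"
  by (simp_all add: witt2_def)

text \<open>The last summand in the product of \<open>witt2\<close> is a multiple of
  \<open>p\<close> and vanishes; what remains has the shape of the product relation of total
  differentials.\<close>

lemma witt2_mult [simp]:
  "a \<in> carrier R \<Longrightarrow> b \<in> carrier R \<Longrightarrow> c \<in> carrier R \<Longrightarrow> d \<in> carrier R \<Longrightarrow>
    (a, b) \<otimes>\<^bsub>W\<^esub> (c, d) = (a \<otimes> c, a [^] p \<otimes> d \<oplus> c [^] p \<otimes> b)"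
  by (simp add: witt2_def)

lemma witt2_cring: "cring W"
proof (rule cringI)
  show "abelian_group W"
  proof (rule abelian_groupI)
    show "x \<oplus>\<^bsub>W\<^esub> y \<in> carrier W" if "x \<in> carrier W" "y \<in> carrier W" for x y
      using that by (cases x, cases y) simp
    show "x \<oplus>\<^bsub>W\<^esub> y = y \<oplus>\<^bsub>W\<^esub> x" if "x \<in> carrier W" "y \<in> carrier W" for x y
      using that Cp_comm[OF p] by (cases x, cases y) (simp add: a_ac)
    show "x \<oplus>\<^bsub>W\<^esub> y \<oplus>\<^bsub>W\<^esub> z = x \<oplus>\<^bsub>W\<^esub> (y \<oplus>\<^bsub>W\<^esub> z)"
      if xyz: "x \<in> carrier W" "y \<in> carrier W" "z \<in> carrier W" for x y z
    proof -
      obtain a a' b b' c c' where eq: "x = (a, a')" "y = (b, b')" "z = (c, c')"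
        by (metis surj_pair)
      have abc: "a \<in> carrier R" "a' \<in> carrier R" "b \<in> carrier R" "b' \<in> carrier R"
        "c \<in> carrier R" "c' \<in> carrier R" using xyz by (auto simp: eq)
      have "a' \<oplus> b' \<oplus> Cp R p a b \<oplus> c' \<oplus> Cp R p (a \<oplus> b) c =
          a' \<oplus> b' \<oplus> c' \<oplus> (Cp R p a b \<oplus> Cp R p (a \<oplus> b) c)"
        using abc by (simp add: a_ac)
      also have "\<dots> = a' \<oplus> (b' \<oplus> c' \<oplus> Cp R p b c) \<oplus> Cp R p a (b \<oplus> c)"
        unfolding Cp_identities(2)[OF p abc(1,3,5)] using abc by (simp add: a_ac)
      finally show ?thesis using abc by (simp add: eq a_assoc)
    qed
    show "\<zero>\<^bsub>W\<^esub> \<oplus>\<^bsub>W\<^esub> x = x" if "x \<in> carrier W" for x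
      using that Cp_zero[OF p] by (cases x) simp
    show "\<exists>y\<in>carrier W. y \<oplus>\<^bsub>W\<^esub> x = \<zero>\<^bsub>W\<^esub>" if "x \<in> carrier W" for x
    proof -
      obtain a b where x: "x = (a, b)" "a \<in> carrier R" "b \<in> carrier R" using \<open>x \<in> carrier W\<close> by auto
      let ?c = "Cp R p (\<ominus> a) a"
      \<comment> \<open>The second component of the inverse must cancel the carry \<open>?c\<close>.
        The prime 2 is allowed here, and for it \<open>?c\<close> is the square of
        \<open>a\<close>.\<close>
      have "\<ominus> (b \<oplus> ?c) \<oplus> b \<oplus> ?c = \<zero>" using x by (simp add: a_assoc l_neg)
      thus ?thesis using x by (intro bexI[of _ "(\<ominus> a, \<ominus> (b \<oplus> ?c))"]) (simp_all add: l_neg)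
    qed
  qed simp
  show "Group.comm_monoid W"
  proof (rule comm_monoidI)
    show "x \<otimes>\<^bsub>W\<^esub> y \<in> carrier W" if "x \<in> carrier W" "y \<in> carrier W" for x y
      using that by auto
    show "x \<otimes>\<^bsub>W\<^esub> y = y \<otimes>\<^bsub>W\<^esub> x" if "x \<in> carrier W" "y \<in> carrier W" for x y
      using that by (auto simp: m_comm a_comm)
    show "\<one>\<^bsub>W\<^esub> \<otimes>\<^bsub>W\<^esub> x = x" if "x \<in> carrier W" for x
      using that by auto
    show "x \<otimes>\<^bsub>W\<^esub> y \<otimes>\<^bsub>W\<^esub> z = x \<otimes>\<^bsub>W\<^esub> (y \<otimes>\<^bsub>W\<^esub> z)"
      if "x \<in> carrier W" "y \<in> carrier W" "z \<in> carrier W" for x y z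
      using that by (auto simp: nat_pow_distrib r_distr a_ac m_ac)
  qed simp
  show "(x \<oplus>\<^bsub>W\<^esub> y) \<otimes>\<^bsub>W\<^esub> z = x \<otimes>\<^bsub>W\<^esub> z \<oplus>\<^bsub>W\<^esub> y \<otimes>\<^bsub>W\<^esub> z"
    if xyz: "x \<in> carrier W" "y \<in> carrier W" "z \<in> carrier W" for x y z
  proof -
    obtain a a' b b' c c' where eq: "x = (a, a')" "y = (b, b')" "z = (c, c')"
      by (metis surj_pair)
    have abc: "a \<in> carrier R" "a' \<in> carrier R" "b \<in> carrier R" "b' \<in> carrier R"
      "c \<in> carrier R" "c' \<in> carrier R" using xyz by (auto simp: eq)
    \<comment> \<open>Homogeneity takes \<open>c [^] p\<close> out of the carry; additivity of the
      Frobenius handles the factor \<open>(a \<oplus> b) [^] p\<close> in front of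
      \<open>c'\<close>.\<close>
    have "Cp R p (a \<otimes> c) (b \<otimes> c) = c [^] p \<otimes> Cp R p a b"
      using Cp_identities(1)[OF p abc(1,3,5)] abc by (simp add: m_comm)
    thus ?thesis using abc by (simp add: eq frob_add l_distr r_distr a_ac)
  qed
qed

end

lemma ring_hom_Cp:
  assumes "cring R" "cring S" "f \<in> ring_hom R S" "x \<in> carrier R" "y \<in> carrier R"
  shows "f (Cp R p x y) = Cp S p (f x) (f y)"
proof -
  interpret f: ring_hom_cring R S f
    using assms by (simp add: ring_hom_cring_def ring_hom_cring_axioms_def)
  have pow: "f ([n] \<cdot>\<^bsub>R\<^esub> z) = [n] \<cdot>\<^bsub>S\<^esub> f z" if "z \<in> carrier R" for n :: nat and z
    using that by (induction n) simp_all
  have "f (\<Oplus>\<^bsub>R\<^esub>i\<in>{1..<p}. [((p choose i) div p)] \<cdot>\<^bsub>R\<^esub> (x [^]\<^bsub>R\<^esub> i \<otimes>\<^bsub>R\<^esub> y [^]\<^bsub>R\<^esub> (p - i))) =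
    (\<Oplus>\<^bsub>S\<^esub>i\<in>{1..<p}. [((p choose i) div p)] \<cdot>\<^bsub>S\<^esub> (f x [^]\<^bsub>S\<^esub> i \<otimes>\<^bsub>S\<^esub> f y [^]\<^bsub>S\<^esub> (p - i)))"
    using assms(4,5) by (subst f.hom_finsum) (auto intro!: f.S.finsum_cong' simp: pow)
  thus ?thesis unfolding Cp_def using assms(4,5) by (subst f.hom_a_inv) auto
qed

lemma witt2_hom:
  assumes "char_p_ring R p" "char_p_ring S p" "f \<in> ring_hom R S"
  shows "(\<lambda>(a, b). (f a, f b)) \<in> ring_hom (witt2 p R) (witt2 p S)"
proof -
  interpret R: char_p_ring R p by fact
  interpret S: char_p_ring S p by fact
  interpret f: ring_hom_cring R S f
    using assms(3) by (simp add: ring_hom_cring_def ring_hom_cring_axioms_def R.cring_axioms S.cring_axioms)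
  show ?thesis
    by (rule ring_hom_memI)
      (auto simp: ring_hom_Cp[OF R.cring_axioms S.cring_axioms assms(3)])
qed

text \<open>Supplies primality, which the theorem states only through the characteristic: a
  factorisation \<open>p = m * n\<close> makes the images of \<open>m\<close> and \<open>n\<close>
  multiply to zero.\<close>

lemma (in domain) has_char_prime:
  assumes ch: "has_char R p" and p: "1 < p"
  shows "Factorial_Ring.prime p"
proof -
  have "m = 1 \<or> m = p" if m: "m dvd p" for m
  proof -
    obtain n where n: "p = m * n" using m by blast
    have "([m] \<cdot> \<one>) \<otimes> ([n] \<cdot> \<one>) = [m] \<cdot> ([n] \<cdot> \<one>)"
      using add_pow_ldistr[of \<one> "[n] \<cdot> \<one>" m] by simp
    also have "\<dots> = [p] \<cdot> \<one>" using add.nat_pow_pow[of \<one> m n] by (simp add: n mult.commute)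
    also have "\<dots> = \<zero>" using ch by (simp add: has_char_def)
    finally have "[m] \<cdot> \<one> = \<zero> \<or> [n] \<cdot> \<one> = \<zero>" by (simp add: integral_iff)
    hence "p dvd m \<or> p dvd n" using ch by (simp add: has_char_def)
    thus ?thesis using n p by (auto dest: dvd_imp_le)
  qed
  thus ?thesis using p by (simp add: prime_nat_iff)
qed

text \<open>By additivity \<open>(x \<ominus> y) [^] p = \<zero>\<close>, and a domain is reduced.
  This gives the uniqueness behind \<open>witt2_delta\<close>; surjectivity of the Frobenius may
  fail.\<close>

lemma (in char_p_ring) frob_inj:
  assumes "domain R" "x \<in> carrier R" "y \<in> carrier R" "x [^] p = y [^] p"
  shows "x = y"
proof -
  interpret domain R by fact
  have "(x \<ominus> y) [^] p \<oplus> y [^] p = x [^] p"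
    using assms frob_add[of "x \<ominus> y" y] by (simp add: a_minus_def a_assoc l_neg)
  hence "(x \<ominus> y) [^] p = \<zero>" using assms by (metis add.r_cancel_one' minus_closed nat_pow_closed)
  moreover have "z = \<zero>" if "z \<in> carrier R" "z [^] n = \<zero>" for z and n :: nat
    using that by (induction n) (auto simp: integral_iff)
  ultimately have "x \<ominus> y = \<zero>" using assms by blast
  thus ?thesis using assms by (simp add: r_right_minus_eq)
qed

text \<open>For \<open>r = (a, b)\<close> the \<open>p\<close>-th power is \<open>(a^p, 0)\<close>,
  so \<open>phi(r) - r^p = (0, b^p)\<close>. On the other hand \<open>p\<close> times a lift of
  \<open>x\<close> is \<open>(0, 1)\<close> times it, namely \<open>(0, x^p)\<close>. Injectivity of
  the Frobenius leaves \<open>x = b\<close>.\<close>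

lemma (in char_p_ring) witt2_delta_eq:
  assumes "domain R" and r: "r \<in> carrier W" and W_p: "[p] \<cdot>\<^bsub>W\<^esub> \<one>\<^bsub>W\<^esub> = (\<zero>, \<one>)"
  shows "witt2_delta p R r = snd r"
proof -
  interpret W: cring W by (rule witt2_cring)
  obtain a b where r: "r = (a, b)" "a \<in> carrier R" "b \<in> carrier R" using r by auto
  have p0: "0 < p" by (rule prime_gt_0_nat[OF p])
  \<comment> \<open>The exponent \<open>n - 1\<close> truncates at \<open>n = 0\<close>, harmlessly,
    since the multiple \<open>[0]\<close> annihilates the term. At \<open>n = p\<close> the second
    component vanishes.\<close>
  have "(a, b) [^]\<^bsub>W\<^esub> n = (a [^] n, [n] \<cdot> (a [^] ((n - 1) * p) \<otimes> b))" for n :: nat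
  proof (induction n)
    case (Suc n)
    have "a [^] (n * p) \<otimes> b \<oplus> [n] \<cdot> (a [^] p \<otimes> (a [^] ((n - 1) * p) \<otimes> b)) = [Suc n] \<cdot> (a [^] (n * p) \<otimes> b)"
    proof (cases n)
      case (Suc m)
      have "a [^] p \<otimes> (a [^] ((n - 1) * p) \<otimes> b) = a [^] (n * p) \<otimes> b"
        using r Suc by (simp add: nat_pow_mult flip: m_assoc)
      thus ?thesis using r by (simp add: a_comm)
    qed (use r in \<open>simp add: add_pow_def\<close>)
    thus ?case using r Suc
      by (simp add: nat_pow_pow add_pow_rdistr)
  qed (use r in \<open>simp add: add_pow_def\<close>)
  hence pow: "r [^]\<^bsub>W\<^esub> p = (a [^] p, \<zero>)" using r by simp
  have frob: "witt2_frob p R r \<ominus>\<^bsub>W\<^esub> r [^]\<^bsub>W\<^esub> p = (\<zero>, b [^] p)"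
  proof -
    have "witt2_frob p R r = (\<zero>, b [^] p) \<oplus>\<^bsub>W\<^esub> (a [^] p, \<zero>)"
      using r Cp_zero[OF p] by (simp add: witt2_frob_def)
    moreover have "(\<zero>, b [^] p) \<in> carrier W" "(a [^] p, \<zero>) \<in> carrier W" using r by auto
    ultimately show ?thesis unfolding pow
      by (simp only: a_minus_def W.a_assoc W.a_inv_closed W.r_neg W.r_zero)
  qed
  have mult: "[p] \<cdot>\<^bsub>W\<^esub> x = (\<zero>, fst x [^] p)" if x: "x \<in> carrier W" for x
  proof -
    have "[p] \<cdot>\<^bsub>W\<^esub> x = (\<zero>, \<one>) \<otimes>\<^bsub>W\<^esub> x"
      using W.add_pow_ldistr[OF W.one_closed x, of p] x by (simp only: W_p W.l_one)
    thus ?thesis using x by auto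
  qed
  show ?thesis
    unfolding witt2_delta_def frob
  proof (rule the_equality)
    show "snd r \<in> carrier R \<and> (\<forall>x'\<in>carrier W. fst x' = snd r \<longrightarrow> [p] \<cdot>\<^bsub>W\<^esub> x' = (\<zero>, b [^] p))"
      using r mult by auto
    fix x assume x: "x \<in> carrier R \<and> (\<forall>x'\<in>carrier W. fst x' = x \<longrightarrow> [p] \<cdot>\<^bsub>W\<^esub> x' = (\<zero>, b [^] p))"
    hence "[p] \<cdot>\<^bsub>W\<^esub> (x, \<zero>) = (\<zero>, b [^] p)" by simp
    hence "x [^] p = b [^] p" using mult[of "(x, \<zero>)"] x by simp
    thus "x = snd r" using frob_inj[OF \<open>domain R\<close>] x r by simp
  qed
qed


section \<open>The lifting property for test algebras in other types\<close>

lemma algebra_via_simps [simp]: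
  "carrier (algebra_via Q f) = carrier Q" "\<one>\<^bsub>algebra_via Q f\<^esub> = \<one>\<^bsub>Q\<^esub>" "\<zero>\<^bsub>algebra_via Q f\<^esub> = \<zero>\<^bsub>Q\<^esub>"
  "x \<otimes>\<^bsub>algebra_via Q f\<^esub> y = x \<otimes>\<^bsub>Q\<^esub> y" "x \<oplus>\<^bsub>algebra_via Q f\<^esub> y = x \<oplus>\<^bsub>Q\<^esub> y"
  "r \<odot>\<^bsub>algebra_via Q f\<^esub> x = f r \<otimes>\<^bsub>Q\<^esub> x"
  by (simp_all add: algebra_via_def)

lemma ring_hom_algebra_via [simp]:
  "ring_hom R (algebra_via Q f) = ring_hom R Q" "ring_hom (algebra_via Q f) R = ring_hom Q R"
  by (simp_all add: ring_hom_def)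

lemma cring_algebra_via:
  assumes "cring Q" shows "cring (algebra_via Q f)"
proof -
  interpret Q: cring Q by fact
  show ?thesis
  proof (rule cringI)
    show "abelian_group (algebra_via Q f)"
      by (rule abelian_groupI) (auto simp: Q.a_ac intro: Q.add.l_inv_ex)
    show "Group.comm_monoid (algebra_via Q f)"
      by (rule comm_monoidI) (auto simp: Q.m_ac)
  qed (simp add: Q.l_distr)
qed

lemma algebra_algebra_via:
  assumes "cring R" "cring Q" "f \<in> ring_hom R Q" shows "algebra R (algebra_via Q f)"
proof -
  interpret f: ring_hom_cring R Q f
    using assms by (simp add: ring_hom_cring_def ring_hom_cring_axioms_def)
  show ?thesis
    by (rule algebraI)
      (auto simp: f.S.l_distr f.S.r_distr f.S.m_assoc cring_algebra_via assms(1,2))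
qed

lemma (in cring) inj_imp_image_ring_is_cring:
  assumes "inj_on f (carrier R)" shows "cring (image_ring f R)"
  using ring_iso_imp_img_cring[OF inj_imp_image_ring_iso[OF assms]]
  by (simp add: image_ring_def image_group_def monoid.defs)

lemma (in ring_hom_ring) kernel_coset_eq_iff:
  assumes "x \<in> carrier R" "y \<in> carrier R"
  shows "a_kernel R S h +> x = a_kernel R S h +> y \<longleftrightarrow> h x = h y"
proof -
  interpret K: ideal "a_kernel R S h" R by (rule kernel_is_ideal)
  show ?thesis
    using assms rcos_imp_homeq[of y x] homeq_imp_rcos[of y x] K.a_repr_independence'[of x y]
      K.a_rcos_self[of x] by metis
qed

text \<open>The ring \<open>Q\<close> has elements outside the type \<open>'u\<close> of test
  algebras, so its structure is copied along \<open>enc\<close> to an algebra \<open>B\<close> in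
  that type. The kernel of \<open>q\<close> then becomes a square-zero ideal \<open>J\<close>, the
  lift is found in \<open>B\<close>, and \<open>dec\<close> carries it back. Linearity over
  \<open>R\<close> is expressed by the values at multiples of the unit.\<close>

lemma formally_smooth_lift:
  fixes R :: "('r, 'x) ring_scheme" and A :: "('r, 'a, 'y) module_scheme"
    and Q :: "('q, 'z) ring_scheme" and S :: "('s, 'w) ring_scheme" and enc :: "'q \<Rightarrow> 'u"
  assumes smooth: "formally_smooth TYPE('u) R A" and A: "algebra R A"
    and Q: "cring Q" and S: "cring S" and enc: "inj_on enc (carrier Q)"
    and j: "j \<in> ring_hom R Q"
    and q: "q \<in> ring_hom Q S" and surj: "q ` carrier Q = carrier S"
    and sq: "\<And>x y. x \<in> carrier Q \<Longrightarrow> y \<in> carrier Q \<Longrightarrow> q x = \<zero>\<^bsub>S\<^esub> \<Longrightarrow> q y = \<zero>\<^bsub>S\<^esub> \<Longrightarrow> x \<otimes>\<^bsub>Q\<^esub> y = \<zero>\<^bsub>Q\<^esub>"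
    and f: "f \<in> ring_hom A S"
    and f_smult: "\<And>r. r \<in> carrier R \<Longrightarrow> f (r \<odot>\<^bsub>A\<^esub> \<one>\<^bsub>A\<^esub>) = q (j r)"
  shows "\<exists>g\<in>ring_hom A Q. (\<forall>a\<in>carrier A. q (g a) = f a) \<and>
    (\<forall>r\<in>carrier R. g (r \<odot>\<^bsub>A\<^esub> \<one>\<^bsub>A\<^esub>) = j r)"
proof -
  interpret A: algebra R A by fact
  interpret Q: cring Q by fact
  interpret S: cring S by fact
  define E where "E = image_ring enc Q"
  define B where "B = algebra_via E (enc \<circ> j)"
  have E: "cring E" unfolding E_def by (rule Q.inj_imp_image_ring_is_cring[OF enc])
  have B: "cring B" unfolding B_def by (rule cring_algebra_via[OF E])
  interpret B: cring B by (rule B)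
  have iso: "enc \<in> ring_iso Q E" unfolding E_def by (rule inj_imp_image_ring_iso[OF enc])
  define dec where "dec = inv_into (carrier Q) enc"
  have "dec \<in> ring_iso E Q"
    unfolding dec_def by (rule ring_iso_set_sym[OF Q.ring_axioms iso])
  hence dec: "dec \<in> ring_hom B Q" by (simp add: B_def ring_iso_def)
  have enc_hom: "enc \<in> ring_hom Q E" using iso by (simp add: ring_iso_def)
  have dec_enc: "dec (enc x) = x" if "x \<in> carrier Q" for x
    unfolding dec_def using enc that by (rule inv_into_f_f)
  have carB: "carrier B = enc ` carrier Q" by (simp add: B_def E_def image_ring_carrier)
  have ej: "enc \<circ> j \<in> ring_hom R E" by (rule ring_hom_trans[OF j enc_hom])
  have algB: "algebra R B" unfolding B_def by (rule algebra_algebra_via[OF A.R_cring E ej])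
  interpret algB: algebra R B by (rule algB)
  have qd: "q \<circ> dec \<in> ring_hom B S" by (rule ring_hom_trans[OF dec q])
  interpret h: ring_hom_ring B S "q \<circ> dec"
    by (rule ring_hom_ringI2[OF B.ring_axioms S.ring_axioms qd])
  define J where "J = a_kernel B S (q \<circ> dec)"
  have J: "ideal J B" unfolding J_def by (rule h.kernel_is_ideal)
  interpret J: ideal J B by (rule J)
  have coset: "J +>\<^bsub>B\<^esub> x = J +>\<^bsub>B\<^esub> y \<longleftrightarrow> (q \<circ> dec) x = (q \<circ> dec) y"
    if "x \<in> carrier B" "y \<in> carrier B" for x y
    unfolding J_def using that by (rule h.kernel_coset_eq_iff)
  have J0: "(q \<circ> dec) x = \<zero>\<^bsub>S\<^esub> \<and> x \<in> carrier B" if "x \<in> J" for x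
    using that unfolding J_def a_kernel_def' by simp
  have J_sq: "x \<otimes>\<^bsub>B\<^esub> y = \<zero>\<^bsub>B\<^esub>" if "x \<in> J" "y \<in> J" for x y
  proof -
    have xy: "x \<in> carrier B" "y \<in> carrier B" "q (dec x) = \<zero>\<^bsub>S\<^esub>" "q (dec y) = \<zero>\<^bsub>S\<^esub>"
      using J0 that by auto
    obtain x' y' where x': "x = enc x'" "x' \<in> carrier Q" and y': "y = enc y'" "y' \<in> carrier Q"
      using xy(1,2) by (auto simp: carB)
    have "x' \<otimes>\<^bsub>Q\<^esub> y' = \<zero>\<^bsub>Q\<^esub>" using sq x' y' xy(3,4) by (simp add: dec_enc)
    hence "enc x' \<otimes>\<^bsub>E\<^esub> enc y' = enc \<zero>\<^bsub>Q\<^esub>"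
      using ring_hom_mult[OF enc_hom x'(2) y'(2)] by simp
    thus ?thesis by (simp add: x' y' B_def E_def image_ring_zero)
  qed
  have "\<exists>b\<in>carrier B. (q \<circ> dec) b = s" if s: "s \<in> carrier S" for s
  proof -
    obtain x where "x \<in> carrier Q" "q x = s" using surj s by (metis imageE)
    thus ?thesis by (intro bexI[of _ "enc x"]) (auto simp: dec_enc carB)
  qed
  then obtain \<sigma> where \<sigma>: "\<And>s. s \<in> carrier S \<Longrightarrow> \<sigma> s \<in> carrier B"
      "\<And>s. s \<in> carrier S \<Longrightarrow> (q \<circ> dec) (\<sigma> s) = s"
    by metis
  have fc: "f a \<in> carrier S" if "a \<in> carrier A" for a using f that by (rule ring_hom_closed)
  have f_smult': "f (r \<odot>\<^bsub>A\<^esub> a) = q (j r) \<otimes>\<^bsub>S\<^esub> f a" if "r \<in> carrier R" "a \<in> carrier A" for r a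
  proof -
    have "r \<odot>\<^bsub>A\<^esub> a = r \<odot>\<^bsub>A\<^esub> \<one>\<^bsub>A\<^esub> \<otimes>\<^bsub>A\<^esub> a" using that by (simp add: A.smult_assoc2)
    thus ?thesis using ring_hom_mult[OF f, of "r \<odot>\<^bsub>A\<^esub> \<one>\<^bsub>A\<^esub>" a] that f_smult by simp
  qed
  \<comment> \<open>\<open>S\<close> is identified with the quotient of \<open>B\<close> by
    \<open>J\<close> through a mere set-theoretic section \<open>\<sigma>\<close>. It need not
    respect the operations, because cosets agree once their images in \<open>S\<close> do.\<close>
  define F where "F a = J +>\<^bsub>B\<^esub> \<sigma> (f a)" for a
  have F: "F \<in> alg_hom R A (quot_algebra B J)"
    unfolding alg_hom_def
  proof (intro CollectI conjI ballI)
    show "F \<in> ring_hom A (quot_algebra B J)"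
      unfolding quot_algebra_def ring_hom_algebra_via
    proof (rule ring_hom_memI)
      show "F a \<in> carrier (B Quot J)" if "a \<in> carrier A" for a
        using \<sigma>(1)[OF fc[OF that]] by (auto simp: F_def FactRing_def A_RCOSETS_def')
      fix a b assume ab: "a \<in> carrier A" "b \<in> carrier A"
      have "\<sigma> (f (a \<otimes>\<^bsub>A\<^esub> b)) \<in> carrier B" "\<sigma> (f (a \<oplus>\<^bsub>A\<^esub> b)) \<in> carrier B"
        using \<sigma>(1) fc ab by simp_all
      moreover have "(q \<circ> dec) (\<sigma> (f a) \<otimes>\<^bsub>B\<^esub> \<sigma> (f b)) = f (a \<otimes>\<^bsub>A\<^esub> b)"
        "(q \<circ> dec) (\<sigma> (f a) \<oplus>\<^bsub>B\<^esub> \<sigma> (f b)) = f (a \<oplus>\<^bsub>A\<^esub> b)"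
        using \<sigma> fc ab ring_hom_mult[OF f ab] ring_hom_add[OF f ab]
        by (simp_all add: h.hom_mult h.hom_add del: o_apply)
      ultimately show "F (a \<otimes>\<^bsub>A\<^esub> b) = F a \<otimes>\<^bsub>B Quot J\<^esub> F b"
        "F (a \<oplus>\<^bsub>A\<^esub> b) = F a \<oplus>\<^bsub>B Quot J\<^esub> F b"
        unfolding F_def FactRing_def using \<sigma> fc ab
        by (simp_all add: J.rcoset_mult_add J.a_rcos_sum coset del: o_apply)
    next
      have "\<sigma> (f \<one>\<^bsub>A\<^esub>) \<in> carrier B" "(q \<circ> dec) (\<sigma> (f \<one>\<^bsub>A\<^esub>)) = \<one>\<^bsub>S\<^esub>"
        using \<sigma> ring_hom_one[OF f] by simp_all
      thus "F \<one>\<^bsub>A\<^esub> = \<one>\<^bsub>B Quot J\<^esub>"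
        unfolding F_def FactRing_def by (simp add: coset del: o_apply)
    qed
    fix r a assume ra: "r \<in> carrier R" "a \<in> carrier A"
    have jr: "j r \<in> carrier Q" using j ra(1) by (rule ring_hom_closed)
    have r1: "r \<odot>\<^bsub>B\<^esub> \<one>\<^bsub>B\<^esub> \<in> carrier B" using ra(1) by simp
    have "r \<odot>\<^bsub>B\<^esub> \<one>\<^bsub>B\<^esub> = enc (j r)"
      using jr cring.axioms[OF E] ring_hom_closed[OF enc_hom jr] monoid.r_one[of E]
      by (simp add: B_def ring_def)
    hence "(q \<circ> dec) (r \<odot>\<^bsub>B\<^esub> \<one>\<^bsub>B\<^esub>) = q (j r)" using jr by (simp add: dec_enc)
    hence "(q \<circ> dec) (r \<odot>\<^bsub>B\<^esub> \<one>\<^bsub>B\<^esub> \<otimes>\<^bsub>B\<^esub> \<sigma> (f a)) = f (r \<odot>\<^bsub>A\<^esub> a)"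
      using h.hom_mult[OF r1 \<sigma>(1)[OF fc[OF ra(2)]]] \<sigma>(2)[OF fc[OF ra(2)]] f_smult'[OF ra] by metis
    moreover have "\<sigma> (f (r \<odot>\<^bsub>A\<^esub> a)) \<in> carrier B" "(q \<circ> dec) (\<sigma> (f (r \<odot>\<^bsub>A\<^esub> a))) = f (r \<odot>\<^bsub>A\<^esub> a)"
      using \<sigma> fc ra by (simp_all del: o_apply)
    ultimately show "F (r \<odot>\<^bsub>A\<^esub> a) = r \<odot>\<^bsub>quot_algebra B J\<^esub> F a"
      unfolding F_def quot_algebra_def algebra_via_simps FactRing_def using \<sigma>(1)[OF fc[OF ra(2)]] r1
      by (simp add: J.rcoset_mult_add coset del: o_apply)
  qed
  then obtain G where G: "G \<in> alg_hom R A B" and GF: "\<And>a. a \<in> carrier A \<Longrightarrow> J +>\<^bsub>B\<^esub> G a = F a"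
  proof -
    have "\<forall>f\<in>alg_hom R A (quot_algebra B J). \<exists>g\<in>alg_hom R A B. \<forall>a\<in>carrier A. J +>\<^bsub>B\<^esub> g a = f a"
      by (rule smooth[unfolded formally_smooth_def, THEN spec, THEN spec, THEN mp]) (use algB J J_sq in auto)
    from bspec[OF this F] show ?thesis using that by (elim bexE) simp
  qed
  have G_hom: "G \<in> ring_hom A B" using G by (simp add: alg_hom_def)
  show ?thesis
  proof (intro bexI[of _ "dec \<circ> G"] conjI ballI)
    show "dec \<circ> G \<in> ring_hom A Q" by (rule ring_hom_trans[OF G_hom dec])
    fix a assume a: "a \<in> carrier A"
    show "q ((dec \<circ> G) a) = f a"
      using GF[OF a] coset[OF ring_hom_closed[OF G_hom a] \<sigma>(1)[OF fc[OF a]]] \<sigma>(2)[OF fc[OF a]]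
      by (simp add: F_def)
  next
    fix r assume r: "r \<in> carrier R"
    have jr: "j r \<in> carrier Q" using j r by (rule ring_hom_closed)
    have "G (r \<odot>\<^bsub>A\<^esub> \<one>\<^bsub>A\<^esub>) = r \<odot>\<^bsub>B\<^esub> \<one>\<^bsub>B\<^esub>"
      using G r ring_hom_one[OF G_hom] by (simp add: alg_hom_def)
    also have "\<dots> = enc (j r)"
      using jr cring.axioms[OF E] ring_hom_closed[OF enc_hom jr] monoid.r_one[of E]
      by (simp add: B_def ring_def)
    finally show "(dec \<circ> G) (r \<odot>\<^bsub>A\<^esub> \<one>\<^bsub>A\<^esub>) = j r" using jr by (simp add: dec_enc)
  qed
qed

text \<open>Two functions on multisets are interleaved according to whether \<open>0\<close> occurs.\<close>

lemma inj_on_pair_encoding: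
  fixes \<theta> :: "(nat multiset \<Rightarrow> 'r) \<Rightarrow> 'c"
  assumes "C \<subseteq> \<theta> ` T"
  shows "\<exists>enc :: 'c \<times> 'c \<Rightarrow> (nat multiset \<Rightarrow> 'r) set. inj_on enc (C \<times> C)"
proof -
  define s where "s = inv_into T \<theta>"
  have s: "\<theta> (s x) = x" if "x \<in> C" for x
    unfolding s_def using f_inv_into_f[of x \<theta> T] assms that by auto
  define pair :: "(nat multiset \<Rightarrow> 'r) \<Rightarrow> (nat multiset \<Rightarrow> 'r) \<Rightarrow> nat multiset \<Rightarrow> 'r"
    where "pair f g m = (if 0 \<in># m then g (image_mset (\<lambda>n. n - 1) (m - {#0#}))
      else f (image_mset (\<lambda>n. n - 1) m))" for f g m
  have pair: "pair f g (image_mset Suc m) = f m" "pair f g (add_mset 0 (image_mset Suc m)) = g m"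
    for f g m by (simp_all add: pair_def multiset.map_comp o_def image_iff)
  \<comment> \<open>The codes are singletons because elements of the test algebras are sets of
    functions.\<close>
  have "inj_on (\<lambda>(x, y). {pair (s x) (s y)}) (C \<times> C)"
  proof (rule inj_onI)
    fix u v assume uv: "u \<in> C \<times> C" "v \<in> C \<times> C"
      and eq: "(case u of (x, y) \<Rightarrow> {pair (s x) (s y)}) = (case v of (x, y) \<Rightarrow> {pair (s x) (s y)})"
    obtain x y x' y' where u: "u = (x, y)" and v: "v = (x', y')" by (metis surj_pair)
    have C: "x \<in> C" "y \<in> C" "x' \<in> C" "y' \<in> C" using uv by (simp_all add: u v)
    have eq: "pair (s x) (s y) = pair (s x') (s y')" using eq by (simp add: u v)
    have "s x = s x'"
    proof
      fix m show "s x m = s x' m"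
        using arg_cong[OF eq, of "\<lambda>h. h (image_mset Suc m)"] by (simp only: pair)
    qed
    moreover have "s y = s y'"
    proof
      fix m show "s y m = s y' m"
        using arg_cong[OF eq, of "\<lambda>h. h (add_mset 0 (image_mset Suc m))"] by (simp only: pair)
    qed
    ultimately show "u = v" unfolding u v using s[OF C(1)] s[OF C(2)] s[OF C(3)] s[OF C(4)] by metis
  qed
  thus ?thesis by (rule exI[where x = "\<lambda>(x, y). {pair (s x) (s y)}"])
qed


section \<open>Universal properties of differentials and of extension of scalars\<close>

lemma linear_mapI:
  "module R M \<Longrightarrow> module R N \<Longrightarrow> f \<in> mod_hom R M N \<Longrightarrow> linear_map R M N f"
  by (simp add: linear_map_def linear_map_axioms_def)

section \<open>Kaehler differentials\<close>

locale kaehler_setup = cring B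
  for k :: "('r, 'x) ring_scheme" and B :: "('r, 'b, 'y) module_scheme" (structure) +
  assumes const_closed: "c \<in> carrier k \<Longrightarrow> c \<odot> \<one> \<in> carrier B"
begin

sublocale K: presentation B "carrier B" "kaehler_rels k B"
proof (unfold_locales)
  interpret F: module B "free_module B (carrier B)" by (rule free_module_module)
  show "kaehler_rels k B \<subseteq> carrier (free_module B (carrier B))"
    unfolding kaehler_rels_def Let_def
    by (auto intro!: F.M.minus_closed F.M.a_closed F.smult_closed free_gen_closed const_closed)
qed

abbreviation "\<Omega> \<equiv> kaehler k B"
abbreviation "d \<equiv> kaehler_d k B"

lemma \<Omega>_module: "module B \<Omega>"
  unfolding kaehler_def by (rule K.P_module)

lemma d_closed: "x \<in> carrier B \<Longrightarrow> d x \<in> carrier \<Omega>"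
  unfolding kaehler_def kaehler_d_def by (rule K.gen_closed)

lemma kaehler_generated:
  "submodule H B \<Omega> \<Longrightarrow> (\<And>x. x \<in> carrier B \<Longrightarrow> d x \<in> H) \<Longrightarrow> carrier \<Omega> \<subseteq> H"
  unfolding kaehler_def kaehler_d_def by (rule K.generated)

lemma
  shows d_add: "x \<in> carrier B \<Longrightarrow> y \<in> carrier B \<Longrightarrow> d (x \<oplus> y) = d x \<oplus>\<^bsub>\<Omega>\<^esub> d y"
    and d_mult: "x \<in> carrier B \<Longrightarrow> y \<in> carrier B \<Longrightarrow>
      d (x \<otimes> y) = y \<odot>\<^bsub>\<Omega>\<^esub> d x \<oplus>\<^bsub>\<Omega>\<^esub> x \<odot>\<^bsub>\<Omega>\<^esub> d y"
    and d_const: "c \<in> carrier k \<Longrightarrow> d (c \<odot> \<one>) = \<zero>\<^bsub>\<Omega>\<^esub>"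
proof -
  let ?F = "free_module B (carrier B)" and ?g = "free_gen B"
  obtain q where "linear_map B ?F \<Omega> q" and qd: "\<And>x. x \<in> carrier B \<Longrightarrow> q (?g x) = d x"
    and rel: "\<And>\<rho>. \<rho> \<in> kaehler_rels k B \<Longrightarrow> q \<rho> = \<zero>\<^bsub>\<Omega>\<^esub>"
    using K.rel_proj unfolding kaehler_def kaehler_d_def by auto
  interpret q: linear_map B ?F \<Omega> q by fact
  note [simp] = free_gen_closed qd q.N.M.diff_eq_zero_iff
  show "d (x \<oplus> y) = d x \<oplus>\<^bsub>\<Omega>\<^esub> d y" if xy: "x \<in> carrier B" "y \<in> carrier B"
  proof -
    have "q (?g (x \<oplus> y) \<ominus>\<^bsub>?F\<^esub> (?g x \<oplus>\<^bsub>?F\<^esub> ?g y)) = \<zero>\<^bsub>\<Omega>\<^esub>"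
      by (rule rel) (use xy in \<open>unfold kaehler_rels_def Let_def, blast\<close>)
    thus ?thesis using xy d_closed by simp
  qed
  show "d (x \<otimes> y) = y \<odot>\<^bsub>\<Omega>\<^esub> d x \<oplus>\<^bsub>\<Omega>\<^esub> x \<odot>\<^bsub>\<Omega>\<^esub> d y"
    if xy: "x \<in> carrier B" "y \<in> carrier B"
  proof -
    have "q (?g (x \<otimes> y) \<ominus>\<^bsub>?F\<^esub> (y \<odot>\<^bsub>?F\<^esub> ?g x \<oplus>\<^bsub>?F\<^esub> x \<odot>\<^bsub>?F\<^esub> ?g y)) = \<zero>\<^bsub>\<Omega>\<^esub>"
      by (rule rel) (use xy in \<open>unfold kaehler_rels_def Let_def, blast\<close>)
    thus ?thesis using xy d_closed by simp
  qed
  show "d (c \<odot> \<one>) = \<zero>\<^bsub>\<Omega>\<^esub>" if "c \<in> carrier k"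
  proof -
    have "q (?g (c \<odot> \<one>)) = \<zero>\<^bsub>\<Omega>\<^esub>"
      by (rule rel) (use that in \<open>unfold kaehler_rels_def Let_def, blast\<close>)
    thus ?thesis using that const_closed by simp
  qed
qed

lemma kaehler_univ:
  fixes N :: "('b, 'n, 'z) module_scheme"
  assumes N: "module B N" and D: "\<And>x. x \<in> carrier B \<Longrightarrow> D x \<in> carrier N"
    and add: "\<And>x y. x \<in> carrier B \<Longrightarrow> y \<in> carrier B \<Longrightarrow> D (x \<oplus> y) = D x \<oplus>\<^bsub>N\<^esub> D y"
    and mult: "\<And>x y. x \<in> carrier B \<Longrightarrow> y \<in> carrier B \<Longrightarrow>
      D (x \<otimes> y) = y \<odot>\<^bsub>N\<^esub> D x \<oplus>\<^bsub>N\<^esub> x \<odot>\<^bsub>N\<^esub> D y"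
    and const: "\<And>c. c \<in> carrier k \<Longrightarrow> D (c \<odot> \<one>) = \<zero>\<^bsub>N\<^esub>"
  shows "\<exists>g. linear_map B \<Omega> N g \<and> (\<forall>x\<in>carrier B. g (d x) = D x)"
  unfolding kaehler_def kaehler_d_def
proof (rule K.univ[OF N D])
  let ?F = "free_module B (carrier B)"
  fix f \<rho> assume "linear_map B ?F N f" and fg: "\<And>x. x \<in> carrier B \<Longrightarrow> f (free_gen B x) = D x"
    and \<rho>: "\<rho> \<in> kaehler_rels k B"
  interpret f: linear_map B ?F N f by fact
  note [simp] = free_gen_closed fg f.N.M.diff_eq_zero_iff D
  show "f \<rho> = \<zero>\<^bsub>N\<^esub>" using \<rho> unfolding kaehler_rels_def Let_def
    by (elim UnE CollectE exE conjE) (simp_all add: add mult const const_closed)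
qed

end

section \<open>Extension and restriction of scalars\<close>

locale scalar_ext_setup = M: module B M + C: cring C
  for B :: "('b, 'x) ring_scheme" and C :: "('c, 'y) ring_scheme"
    and f :: "'b \<Rightarrow> 'c" and M :: "('b, 'm, 'z) module_scheme" +
  assumes f_hom: "f \<in> ring_hom B C"
begin

lemma f_closed: "b \<in> carrier B \<Longrightarrow> f b \<in> carrier C"
  using f_hom by (rule ring_hom_closed)

sublocale E: presentation C "carrier M \<times> carrier C" "scalar_ext_rels B C f M"
proof (unfold_locales)
  interpret F: module C "free_module C (carrier M \<times> carrier C)" by (rule C.free_module_module)
  show "scalar_ext_rels B C f M \<subseteq> carrier (free_module C (carrier M \<times> carrier C))"
    unfolding scalar_ext_rels_def Let_def
    by (auto intro!: F.M.minus_closed F.M.a_closed F.smult_closed C.free_gen_closed f_closed)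
qed

abbreviation "P \<equiv> scalar_ext B C f M"
abbreviation "t \<equiv> scalar_ext_tensor B C f M"

lemma P_module: "module C P"
  unfolding scalar_ext_def by (rule E.P_module)

lemma tensor_closed: "m \<in> carrier M \<Longrightarrow> s \<in> carrier C \<Longrightarrow> t m s \<in> carrier P"
  unfolding scalar_ext_def scalar_ext_tensor_def by (rule E.gen_closed) simp

lemma tensor_generated:
  assumes "submodule H C P" "\<And>m s. m \<in> carrier M \<Longrightarrow> s \<in> carrier C \<Longrightarrow> t m s \<in> H"
  shows "carrier P \<subseteq> H"
  using assms unfolding scalar_ext_def scalar_ext_tensor_def by (intro E.generated) auto

lemma
  shows tensor_add_left: "m \<in> carrier M \<Longrightarrow> m' \<in> carrier M \<Longrightarrow> s \<in> carrier C \<Longrightarrow>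
      t (m \<oplus>\<^bsub>M\<^esub> m') s = t m s \<oplus>\<^bsub>P\<^esub> t m' s"
    and tensor_balanced: "b \<in> carrier B \<Longrightarrow> m \<in> carrier M \<Longrightarrow> s \<in> carrier C \<Longrightarrow>
      t (b \<odot>\<^bsub>M\<^esub> m) s = t m (f b \<otimes>\<^bsub>C\<^esub> s)"
    and tensor_smult: "c \<in> carrier C \<Longrightarrow> m \<in> carrier M \<Longrightarrow> s \<in> carrier C \<Longrightarrow>
      t m (c \<otimes>\<^bsub>C\<^esub> s) = c \<odot>\<^bsub>P\<^esub> t m s"
proof -
  let ?F = "free_module C (carrier M \<times> carrier C)" and ?g = "\<lambda>m s. free_gen C (m, s)"
  obtain q where "linear_map C ?F P q"
    and qt: "\<And>m s. m \<in> carrier M \<Longrightarrow> s \<in> carrier C \<Longrightarrow> q (?g m s) = t m s"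
    and rel: "\<And>\<rho>. \<rho> \<in> scalar_ext_rels B C f M \<Longrightarrow> q \<rho> = \<zero>\<^bsub>P\<^esub>"
    using E.rel_proj unfolding scalar_ext_def scalar_ext_tensor_def by auto
  interpret q: linear_map C ?F P q by fact
  note [simp] = C.free_gen_closed qt q.N.M.diff_eq_zero_iff tensor_closed f_closed
  show "t (m \<oplus>\<^bsub>M\<^esub> m') s = t m s \<oplus>\<^bsub>P\<^esub> t m' s"
    if a: "m \<in> carrier M" "m' \<in> carrier M" "s \<in> carrier C"
  proof -
    have "q (?g (m \<oplus>\<^bsub>M\<^esub> m') s \<ominus>\<^bsub>?F\<^esub> (?g m s \<oplus>\<^bsub>?F\<^esub> ?g m' s)) = \<zero>\<^bsub>P\<^esub>"
      by (rule rel) (use a in \<open>unfold scalar_ext_rels_def Let_def, blast\<close>)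
    thus ?thesis using a by simp
  qed
  show "t (b \<odot>\<^bsub>M\<^esub> m) s = t m (f b \<otimes>\<^bsub>C\<^esub> s)"
    if a: "b \<in> carrier B" "m \<in> carrier M" "s \<in> carrier C"
  proof -
    have "q (?g (b \<odot>\<^bsub>M\<^esub> m) s \<ominus>\<^bsub>?F\<^esub> ?g m (f b \<otimes>\<^bsub>C\<^esub> s)) = \<zero>\<^bsub>P\<^esub>"
      by (rule rel) (use a in \<open>unfold scalar_ext_rels_def Let_def, blast\<close>)
    thus ?thesis using a by simp
  qed
  show "t m (c \<otimes>\<^bsub>C\<^esub> s) = c \<odot>\<^bsub>P\<^esub> t m s"
    if a: "c \<in> carrier C" "m \<in> carrier M" "s \<in> carrier C"
  proof -
    have "q (?g m (c \<otimes>\<^bsub>C\<^esub> s) \<ominus>\<^bsub>?F\<^esub> c \<odot>\<^bsub>?F\<^esub> ?g m s) = \<zero>\<^bsub>P\<^esub>"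
      by (rule rel) (use a in \<open>unfold scalar_ext_rels_def Let_def, blast\<close>)
    thus ?thesis using a by simp
  qed
qed

text \<open>Extension of scalars is left adjoint to restriction: \<open>D\<close> is linear into
  \<open>N\<close> with scalars restricted along \<open>f\<close>, and \<open>m \<otimes> s\<close>
  must go to the multiple of \<open>D m\<close> by \<open>s\<close>.\<close>

lemma tensor_univ:
  fixes N :: "('c, 'n, 'w) module_scheme"
  assumes N: "module C N" and D: "\<And>m. m \<in> carrier M \<Longrightarrow> D m \<in> carrier N"
    and add: "\<And>m m'. m \<in> carrier M \<Longrightarrow> m' \<in> carrier M \<Longrightarrow> D (m \<oplus>\<^bsub>M\<^esub> m') = D m \<oplus>\<^bsub>N\<^esub> D m'"
    and smult: "\<And>b m. b \<in> carrier B \<Longrightarrow> m \<in> carrier M \<Longrightarrow> D (b \<odot>\<^bsub>M\<^esub> m) = f b \<odot>\<^bsub>N\<^esub> D m"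
  shows "\<exists>g. linear_map C P N g \<and> (\<forall>m\<in>carrier M. \<forall>s\<in>carrier C. g (t m s) = s \<odot>\<^bsub>N\<^esub> D m)"
proof -
  interpret N: module C N by (rule N)
  let ?F = "free_module C (carrier M \<times> carrier C)"
  have "\<exists>g. linear_map C E.P N g \<and>
      (\<forall>x\<in>carrier M \<times> carrier C. g (E.gen x) = (case x of (m, s) \<Rightarrow> s \<odot>\<^bsub>N\<^esub> D m))"
  proof (rule E.univ[OF N])
    show "(case x of (m, s) \<Rightarrow> s \<odot>\<^bsub>N\<^esub> D m) \<in> carrier N" if "x \<in> carrier M \<times> carrier C" for x
      using that D by auto
    fix h \<rho> assume "linear_map C ?F N h"
      and hg: "\<And>x. x \<in> carrier M \<times> carrier C \<Longrightarrow>
        h (free_gen C x) = (case x of (m, s) \<Rightarrow> s \<odot>\<^bsub>N\<^esub> D m)"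
      and \<rho>: "\<rho> \<in> scalar_ext_rels B C f M"
    interpret h: linear_map C ?F N h by fact
    note [simp] = C.free_gen_closed hg N.M.diff_eq_zero_iff D f_closed
      show "h \<rho> = \<zero>\<^bsub>N\<^esub>" using \<rho> unfolding scalar_ext_rels_def Let_def
      by (elim UnE CollectE exE conjE)
        (simp_all add: add smult N.smult_l_distr N.smult_r_distr N.smult_assoc1[symmetric] C.m_comm)
  qed
  thus ?thesis unfolding scalar_ext_def scalar_ext_tensor_def by auto
qed

end

text \<open>With \<open>f\<close> the Frobenius, a derivation along the Frobenius becomes an
  ordinary derivation into the restricted module, to which \<open>kaehler_univ\<close>
  applies.\<close>

lemma module_restrict_scalars:
  fixes N :: "('b, 'n, 'z) module_scheme"
  assumes "module C N" "cring B" "f \<in> ring_hom B C"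
  shows "module B (N\<lparr>smult := \<lambda>b x. f b \<odot>\<^bsub>N\<^esub> x\<rparr>)"
proof -
  interpret N: module C N by fact
  interpret f: ring_hom_cring B C f
    using assms(2,3) N.R.cring_axioms by (simp add: ring_hom_cring_def ring_hom_cring_axioms_def)
  have "abelian_group (N\<lparr>smult := \<lambda>b x. f b \<odot>\<^bsub>N\<^esub> x\<rparr>)"
    by (rule abelian_groupI) (auto simp: N.M.a_ac intro: N.M.add.l_inv_ex)
  thus ?thesis
    by (intro moduleI)
      (auto simp: assms(2) N.smult_l_distr N.smult_r_distr N.smult_assoc1)
qed


section \<open>Total \<open>p\<close>-differentials\<close>

lemma (in ring_hom_ring) hom_add_pow:
  fixes n :: nat
  shows "x \<in> carrier R \<Longrightarrow> h ([n] \<cdot> x) = [n] \<cdot>\<^bsub>S\<^esub> h x"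
  by (induction n) simp_all

section \<open>The reduction of an algebra over \<open>W_2(k)\<close>\<close>

locale witt_algebra = k: field k + AR: cring A + A: algebra "witt2 p k" A
  for k :: "('k, 'x) ring_scheme" and p :: nat and A :: "('k \<times> 'k, 'a, 'y) module_scheme" +
  assumes ch: "has_char k p" and p_gt_1: "1 < p"
begin

lemma prime_p: "Factorial_Ring.prime p"
  using ch p_gt_1 by (rule k.has_char_prime)

sublocale kp: char_p_ring k p
  using ch prime_p by unfold_locales (simp_all add: has_char_def)

abbreviation "I \<equiv> red_ideal k p A"
abbreviation "A0 \<equiv> reduction k p A"
abbreviation "\<pi> \<equiv> red_map k p A"
abbreviation "pA \<equiv> [p] \<cdot>\<^bsub>A\<^esub> \<one>\<^bsub>A\<^esub>"

lemma I_gens: "{r \<odot>\<^bsub>A\<^esub> \<one>\<^bsub>A\<^esub> | r. r \<in> carrier kp.W \<and> fst r = \<zero>\<^bsub>k\<^esub>} \<subseteq> carrier A"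
  by (auto simp del: kp.witt2_simps)

sublocale I: ideal I A
  unfolding red_ideal_def by (rule AR.genideal_ideal[OF I_gens])

sublocale A0: cring A0
  unfolding reduction_def by (rule cring_algebra_via[OF I.quotient_is_cring[OF AR.cring_axioms]])

lemma \<pi>_hom: "\<pi> \<in> ring_hom A A0"
  using I.rcos_ring_hom unfolding reduction_def red_map_def ring_hom_algebra_via .

sublocale \<pi>: ring_hom_ring A A0 \<pi>
  by (rule ring_hom_ringI2[OF AR.ring_axioms A0.ring_axioms \<pi>_hom])

lemma \<pi>_surj: "carrier A0 = \<pi> ` carrier A"
  by (auto simp: reduction_def red_map_def FactRing_def A_RCOSETS_def')

lemma \<pi>_eq_zero: "i \<in> I \<Longrightarrow> \<pi> i = \<zero>\<^bsub>A0\<^esub>"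
  using I.a_rcos_const by (simp add: reduction_def red_map_def FactRing_def)

lemma \<pi>_eq_iff: "a \<in> carrier A \<Longrightarrow> b \<in> carrier A \<Longrightarrow> \<pi> a = \<pi> b \<longleftrightarrow> a \<ominus>\<^bsub>A\<^esub> b \<in> I"
  using AR.quotient_eq_iff_same_a_r_cos[OF I.ideal_axioms] by (simp add: red_map_def)

text \<open>The structure map of \<open>A0\<close> over \<open>k\<close>: the Teichmueller
  representative \<open>(c, 0)\<close> followed by reduction.\<close>

definition \<iota> :: "'k \<Rightarrow> 'a set" where
  "\<iota> c = \<pi> ((c, \<zero>\<^bsub>k\<^esub>) \<odot>\<^bsub>A\<^esub> \<one>\<^bsub>A\<^esub>)"

lemma unit_hom: "(\<lambda>r. r \<odot>\<^bsub>A\<^esub> \<one>\<^bsub>A\<^esub>) \<in> ring_hom kp.W A"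
  by (rule ring_hom_memI)
    (auto simp: A.smult_l_distr A.smult_assoc1 A.smult_assoc2 simp del: kp.witt2_simps)

lemma unit_closed: "r \<in> carrier kp.W \<Longrightarrow> r \<odot>\<^bsub>A\<^esub> \<one>\<^bsub>A\<^esub> \<in> carrier A"
  by (rule ring_hom_closed[OF unit_hom])

lemma \<pi>_unit_hom: "(\<lambda>r. \<pi> (r \<odot>\<^bsub>A\<^esub> \<one>\<^bsub>A\<^esub>)) \<in> ring_hom kp.W A0"
  using ring_hom_trans[OF unit_hom \<pi>_hom] by (simp add: comp_def)

text \<open>A Witt vector is \<open>(0, e)\<close> plus the Teichmueller representative
  \<open>(c, 0)\<close>, and \<open>(0, e)\<close> acts as a generator of the ideal that is divided
  out.\<close>

lemma \<pi>_unit: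
  assumes r: "r \<in> carrier kp.W" shows "\<pi> (r \<odot>\<^bsub>A\<^esub> \<one>\<^bsub>A\<^esub>) = \<iota> (fst r)"
proof -
  obtain c e where ce: "r = (c, e)" "c \<in> carrier k" "e \<in> carrier k" using r by auto
  have W: "(c, \<zero>\<^bsub>k\<^esub>) \<in> carrier kp.W" "(\<zero>\<^bsub>k\<^esub>, e) \<in> carrier kp.W" using ce by auto
  have "r = (\<zero>\<^bsub>k\<^esub>, e) \<oplus>\<^bsub>kp.W\<^esub> (c, \<zero>\<^bsub>k\<^esub>)" using ce by (simp add: k.Cp_zero[OF prime_p])
  hence "\<pi> (r \<odot>\<^bsub>A\<^esub> \<one>\<^bsub>A\<^esub>) = \<pi> ((\<zero>\<^bsub>k\<^esub>, e) \<odot>\<^bsub>A\<^esub> \<one>\<^bsub>A\<^esub>) \<oplus>\<^bsub>A0\<^esub> \<iota> c"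
    using ring_hom_add[OF \<pi>_unit_hom W(2,1)] by (simp add: \<iota>_def)
  moreover have "(\<zero>\<^bsub>k\<^esub>, e) \<odot>\<^bsub>A\<^esub> \<one>\<^bsub>A\<^esub> \<in> I"
    unfolding red_ideal_def using AR.genideal_self[OF I_gens] W(2) by force
  moreover have "\<iota> c \<in> carrier A0" unfolding \<iota>_def using unit_closed[OF W(1)] by simp
  ultimately show ?thesis by (simp add: \<pi>_eq_zero ce)
qed

text \<open>Teichmueller representatives are not additive, but the carry of their sum sits in the
  second component, which reduction discards.\<close>

lemma \<iota>_hom: "\<iota> \<in> ring_hom k A0"
proof (rule ring_hom_memI)
  have W: "(c, \<zero>\<^bsub>k\<^esub>) \<in> carrier kp.W" if "c \<in> carrier k" for c using that by simp
  show "\<iota> c \<in> carrier A0" if "c \<in> carrier k" for c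
    unfolding \<iota>_def using unit_closed[OF W[OF that]] by simp
  fix c e assume ce: "c \<in> carrier k" "e \<in> carrier k"
  note ce' = W[OF ce(1)] W[OF ce(2)]
  have "\<iota> c \<otimes>\<^bsub>A0\<^esub> \<iota> e = \<pi> (((c, \<zero>\<^bsub>k\<^esub>) \<otimes>\<^bsub>kp.W\<^esub> (e, \<zero>\<^bsub>k\<^esub>)) \<odot>\<^bsub>A\<^esub> \<one>\<^bsub>A\<^esub>)"
    unfolding \<iota>_def by (rule ring_hom_mult[OF \<pi>_unit_hom ce', symmetric])
  also have "\<dots> = \<iota> (c \<otimes>\<^bsub>k\<^esub> e)" using ce by (subst \<pi>_unit) simp_all
  finally show "\<iota> (c \<otimes>\<^bsub>k\<^esub> e) = \<iota> c \<otimes>\<^bsub>A0\<^esub> \<iota> e" ..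
  have "\<iota> c \<oplus>\<^bsub>A0\<^esub> \<iota> e = \<pi> (((c, \<zero>\<^bsub>k\<^esub>) \<oplus>\<^bsub>kp.W\<^esub> (e, \<zero>\<^bsub>k\<^esub>)) \<odot>\<^bsub>A\<^esub> \<one>\<^bsub>A\<^esub>)"
    unfolding \<iota>_def by (rule ring_hom_add[OF \<pi>_unit_hom ce', symmetric])
  also have "\<dots> = \<iota> (c \<oplus>\<^bsub>k\<^esub> e)" using ce by (subst \<pi>_unit) simp_all
  finally show "\<iota> (c \<oplus>\<^bsub>k\<^esub> e) = \<iota> c \<oplus>\<^bsub>A0\<^esub> \<iota> e" ..
next
  show "\<iota> \<one>\<^bsub>k\<^esub> = \<one>\<^bsub>A0\<^esub>" using ring_hom_one[OF \<pi>_unit_hom] by (simp add: \<iota>_def)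
qed

sublocale \<iota>: ring_hom_ring k A0 \<iota>
  by (rule ring_hom_ringI2[OF k.ring_axioms A0.ring_axioms \<iota>_hom])

lemma A0_smult: "c \<odot>\<^bsub>A0\<^esub> x = \<iota> c \<otimes>\<^bsub>A0\<^esub> x"
  by (simp add: reduction_def \<iota>_def)

lemma witt2_p: "[p] \<cdot>\<^bsub>kp.W\<^esub> \<one>\<^bsub>kp.W\<^esub> = (\<zero>\<^bsub>k\<^esub>, \<one>\<^bsub>k\<^esub>)"
  by (rule witt2_p_one[OF k.cring_axioms ch prime_p])

text \<open>This form of \<open>p\<close> serves twice: its first component \<open>0\<close> makes
  \<open>pA\<close> vanish in \<open>A0\<close>, and its second component \<open>1\<close> is the
  value of the retraction at \<open>dtot pA\<close>.\<close>

lemma pA_eq: "pA = (\<zero>\<^bsub>k\<^esub>, \<one>\<^bsub>k\<^esub>) \<odot>\<^bsub>A\<^esub> \<one>\<^bsub>A\<^esub>"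
proof -
  interpret u: ring_hom_ring kp.W A "\<lambda>r. r \<odot>\<^bsub>A\<^esub> \<one>\<^bsub>A\<^esub>"
    by (rule ring_hom_ringI2[OF cring.axioms(1)[OF kp.witt2_cring] AR.ring_axioms unit_hom])
  show ?thesis
    using u.hom_add_pow[of "\<one>\<^bsub>kp.W\<^esub>" p] u.hom_one k.one_closed k.zero_closed
    by (simp add: witt2_p[unfolded kp.witt2_simps])
qed

lemma \<pi>_pA: "\<pi> pA = \<zero>\<^bsub>A0\<^esub>"
  unfolding pA_eq by (subst \<pi>_unit) simp_all

sublocale A0p: char_p_ring A0 p
  using \<pi>_pA \<pi>.hom_add_pow[OF AR.one_closed, of p] prime_p by unfold_locales simp_all

lemma pA_closed: "pA \<in> carrier A"
  by simp

sublocale K: kaehler_setup k A0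
  by unfold_locales (simp add: A0_smult)

sublocale E: scalar_ext_setup A0 A0 "\<lambda>b. b [^]\<^bsub>A0\<^esub> p" K.\<Omega>
  by (intro scalar_ext_setup.intro scalar_ext_setup_axioms.intro K.\<Omega>_module A0.cring_axioms
      A0p.frob_hom)

section \<open>Relations and universal property of the total differential\<close>

lemma delta_eq: "r \<in> carrier kp.W \<Longrightarrow> witt2_delta p k r = snd r"
  using kp.witt2_delta_eq[OF k.domain_axioms _ witt2_p] .

sublocale T: presentation A0 "carrier A" "tot_rels k p A"
proof (unfold_locales)
  interpret F: module A0 "free_module A0 (carrier A)" by (rule A0.free_module_module)
  have Cp: "\<pi> (Cp A p a b) \<in> carrier A0" if "a \<in> carrier A" "b \<in> carrier A" for a b
    using that by simp
  have delta: "witt2_delta p k r \<odot>\<^bsub>A0\<^esub> \<one>\<^bsub>A0\<^esub> \<in> carrier A0" if "r \<in> carrier kp.W" for r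
    using that by (auto simp: delta_eq A0_smult)
  show "tot_rels k p A \<subseteq> carrier (free_module A0 (carrier A))"
    unfolding tot_rels_def Let_def
    by (auto intro!: F.M.minus_closed F.M.a_closed F.smult_closed A0.free_gen_closed Cp delta
        unit_closed simp del: kp.witt2_simps A0p.witt2_simps)
qed

abbreviation "\<Omega>tot \<equiv> tot_diff k p A"
abbreviation "dtot \<equiv> tot_d k p A"

lemma \<Omega>tot_module: "module A0 \<Omega>tot"
  unfolding tot_diff_def by (rule T.P_module)

lemma dtot_closed: "a \<in> carrier A \<Longrightarrow> dtot a \<in> carrier \<Omega>tot"
  unfolding tot_diff_def tot_d_def by (rule T.gen_closed)

lemma tot_generated:
  "submodule H A0 \<Omega>tot \<Longrightarrow> (\<And>a. a \<in> carrier A \<Longrightarrow> dtot a \<in> H) \<Longrightarrow> carrier \<Omega>tot \<subseteq> H"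
  unfolding tot_diff_def tot_d_def by (rule T.generated)

lemma \<pi>_Cp: "a \<in> carrier A \<Longrightarrow> b \<in> carrier A \<Longrightarrow> \<pi> (Cp A p a b) = Cp A0 p (\<pi> a) (\<pi> b)"
  by (rule ring_hom_Cp[OF AR.cring_axioms A0.cring_axioms \<pi>_hom])

lemma delta_smult: "r \<in> carrier kp.W \<Longrightarrow> witt2_delta p k r \<odot>\<^bsub>A0\<^esub> \<one>\<^bsub>A0\<^esub> = \<iota> (snd r)"
  by (auto simp: delta_eq A0_smult)

text \<open>The coefficients are rewritten in terms of \<open>A0\<close> alone: \<open>C_p\<close>
  commutes with reduction and \<open>witt2_delta\<close> is the second component. In this form they
  match the operations of Witt vectors over \<open>A0\<close>.\<close>

lemma
  shows dtot_add: "a \<in> carrier A \<Longrightarrow> b \<in> carrier A \<Longrightarrow> dtot (a \<oplus>\<^bsub>A\<^esub> b) =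
      dtot a \<oplus>\<^bsub>\<Omega>tot\<^esub> dtot b \<oplus>\<^bsub>\<Omega>tot\<^esub> Cp A0 p (\<pi> a) (\<pi> b) \<odot>\<^bsub>\<Omega>tot\<^esub> dtot pA"
    and dtot_mult: "a \<in> carrier A \<Longrightarrow> b \<in> carrier A \<Longrightarrow> dtot (a \<otimes>\<^bsub>A\<^esub> b) =
      \<pi> b [^]\<^bsub>A0\<^esub> p \<odot>\<^bsub>\<Omega>tot\<^esub> dtot a \<oplus>\<^bsub>\<Omega>tot\<^esub> \<pi> a [^]\<^bsub>A0\<^esub> p \<odot>\<^bsub>\<Omega>tot\<^esub> dtot b"
    and dtot_unit: "r \<in> carrier kp.W \<Longrightarrow> dtot (r \<odot>\<^bsub>A\<^esub> \<one>\<^bsub>A\<^esub>) = \<iota> (snd r) \<odot>\<^bsub>\<Omega>tot\<^esub> dtot pA"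
proof -
  let ?F = "free_module A0 (carrier A)" and ?g = "free_gen A0"
  obtain q where "linear_map A0 ?F \<Omega>tot q" and qd: "\<And>a. a \<in> carrier A \<Longrightarrow> q (?g a) = dtot a"
    and rel: "\<And>\<rho>. \<rho> \<in> tot_rels k p A \<Longrightarrow> q \<rho> = \<zero>\<^bsub>\<Omega>tot\<^esub>"
    using T.rel_proj unfolding tot_diff_def tot_d_def by auto
  interpret q: linear_map A0 ?F \<Omega>tot q by fact
  note [simp] = A0.free_gen_closed qd q.N.M.diff_eq_zero_iff dtot_closed \<pi>_Cp
  note [simp del] = kp.witt2_simps
  show "dtot (a \<oplus>\<^bsub>A\<^esub> b) =
      dtot a \<oplus>\<^bsub>\<Omega>tot\<^esub> dtot b \<oplus>\<^bsub>\<Omega>tot\<^esub> Cp A0 p (\<pi> a) (\<pi> b) \<odot>\<^bsub>\<Omega>tot\<^esub> dtot pA"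
    if ab: "a \<in> carrier A" "b \<in> carrier A"
  proof -
    have "q (?g (a \<oplus>\<^bsub>A\<^esub> b) \<ominus>\<^bsub>?F\<^esub> (?g a \<oplus>\<^bsub>?F\<^esub> ?g b \<oplus>\<^bsub>?F\<^esub> \<pi> (Cp A p a b) \<odot>\<^bsub>?F\<^esub> ?g pA)) = \<zero>\<^bsub>\<Omega>tot\<^esub>"
      by (rule rel) (use ab in \<open>unfold tot_rels_def Let_def, blast\<close>)
    thus ?thesis using ab by simp
  qed
  show "dtot (a \<otimes>\<^bsub>A\<^esub> b) =
      \<pi> b [^]\<^bsub>A0\<^esub> p \<odot>\<^bsub>\<Omega>tot\<^esub> dtot a \<oplus>\<^bsub>\<Omega>tot\<^esub> \<pi> a [^]\<^bsub>A0\<^esub> p \<odot>\<^bsub>\<Omega>tot\<^esub> dtot b"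
    if ab: "a \<in> carrier A" "b \<in> carrier A"
  proof -
    have "q (?g (a \<otimes>\<^bsub>A\<^esub> b) \<ominus>\<^bsub>?F\<^esub>
        (\<pi> (b [^]\<^bsub>A\<^esub> p) \<odot>\<^bsub>?F\<^esub> ?g a \<oplus>\<^bsub>?F\<^esub> \<pi> (a [^]\<^bsub>A\<^esub> p) \<odot>\<^bsub>?F\<^esub> ?g b)) = \<zero>\<^bsub>\<Omega>tot\<^esub>"
      by (rule rel) (use ab in \<open>unfold tot_rels_def Let_def, blast\<close>)
    thus ?thesis using ab by (simp add: \<pi>.hom_nat_pow)
  qed
  show "dtot (r \<odot>\<^bsub>A\<^esub> \<one>\<^bsub>A\<^esub>) = \<iota> (snd r) \<odot>\<^bsub>\<Omega>tot\<^esub> dtot pA" if r: "r \<in> carrier kp.W"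
  proof -
    have "q (?g (r \<odot>\<^bsub>A\<^esub> \<one>\<^bsub>A\<^esub>) \<ominus>\<^bsub>?F\<^esub> (witt2_delta p k r \<odot>\<^bsub>A0\<^esub> \<one>\<^bsub>A0\<^esub>) \<odot>\<^bsub>?F\<^esub> ?g pA) = \<zero>\<^bsub>\<Omega>tot\<^esub>"
      by (rule rel) (use r in \<open>unfold tot_rels_def Let_def, blast\<close>)
    moreover have "\<iota> (snd r) \<in> carrier A0" using r by (auto simp: kp.witt2_simps)
    ultimately show ?thesis using r by (simp add: delta_smult unit_closed)
  qed
qed

lemma tot_univ:
  fixes N :: "('a set, 'n, 'z) module_scheme"
  assumes N: "module A0 N" and D: "\<And>a. a \<in> carrier A \<Longrightarrow> D a \<in> carrier N"
    and add: "\<And>a b. a \<in> carrier A \<Longrightarrow> b \<in> carrier A \<Longrightarrow>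
      D (a \<oplus>\<^bsub>A\<^esub> b) = D a \<oplus>\<^bsub>N\<^esub> D b \<oplus>\<^bsub>N\<^esub> Cp A0 p (\<pi> a) (\<pi> b) \<odot>\<^bsub>N\<^esub> D pA"
    and mult: "\<And>a b. a \<in> carrier A \<Longrightarrow> b \<in> carrier A \<Longrightarrow>
      D (a \<otimes>\<^bsub>A\<^esub> b) = \<pi> b [^]\<^bsub>A0\<^esub> p \<odot>\<^bsub>N\<^esub> D a \<oplus>\<^bsub>N\<^esub> \<pi> a [^]\<^bsub>A0\<^esub> p \<odot>\<^bsub>N\<^esub> D b"
    and unit: "\<And>r. r \<in> carrier kp.W \<Longrightarrow> D (r \<odot>\<^bsub>A\<^esub> \<one>\<^bsub>A\<^esub>) = \<iota> (snd r) \<odot>\<^bsub>N\<^esub> D pA"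
  shows "\<exists>g. linear_map A0 \<Omega>tot N g \<and> (\<forall>a\<in>carrier A. g (dtot a) = D a)"
  unfolding tot_diff_def tot_d_def
proof (rule T.univ[OF N D])
  let ?F = "free_module A0 (carrier A)"
  fix f \<rho> assume "linear_map A0 ?F N f"
    and fg: "\<And>a. a \<in> carrier A \<Longrightarrow> f (free_gen A0 a) = D a"
    and \<rho>: "\<rho> \<in> tot_rels k p A"
  interpret f: linear_map A0 ?F N f by fact
  have snd: "\<iota> (snd r) \<in> carrier A0" if "r \<in> carrier kp.W" for r using that by auto
  note [simp] = A0.free_gen_closed fg f.N.M.diff_eq_zero_iff D \<pi>_Cp
  note [simp del] = kp.witt2_simps
  show "f \<rho> = \<zero>\<^bsub>N\<^esub>" using \<rho> unfolding tot_rels_def Let_def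
    by (elim UnE CollectE exE conjE)
      (simp_all add: add mult unit \<pi>.hom_nat_pow delta_smult snd unit_closed)
qed

end


section \<open>The exact sequence\<close>

context witt_algebra
begin

abbreviation "F\<Omega> \<equiv> frob_pullback p A0 K.\<Omega>"
abbreviation "dpA \<equiv> submodule_gen A0 \<Omega>tot {dtot pA}"

section \<open>The map to the Frobenius pullback and its surjectivity\<close>

lemma d_zero: "K.d \<zero>\<^bsub>A0\<^esub> = \<zero>\<^bsub>K.\<Omega>\<^esub>"
  using K.d_const[OF k.zero_closed] by (simp add: A0_smult)

lemma tensor_zero:
  assumes s: "s \<in> carrier A0" shows "E.t \<zero>\<^bsub>K.\<Omega>\<^esub> s = \<zero>\<^bsub>F\<Omega>\<^esub>"
proof -
  interpret P: module A0 F\<Omega> by (rule E.P_module)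
  have "E.t \<zero>\<^bsub>K.\<Omega>\<^esub> s \<oplus>\<^bsub>F\<Omega>\<^esub> E.t \<zero>\<^bsub>K.\<Omega>\<^esub> s = E.t \<zero>\<^bsub>K.\<Omega>\<^esub> s"
    using E.tensor_add_left[of "\<zero>\<^bsub>K.\<Omega>\<^esub>" "\<zero>\<^bsub>K.\<Omega>\<^esub>" s] s by simp
  thus ?thesis using E.tensor_closed[OF E.M.M.zero_closed s] by (metis P.M.add.r_cancel_one')
qed

text \<open>Since \<open>pA\<close> reduces to zero, every multiple of \<open>dtot pA\<close> in the
  relations goes to zero. The product relation becomes the Leibniz rule, because a scalar
  \<open>b\<close> crosses the tensor sign as \<open>b^p\<close>.\<close>

lemma ex_\<beta>:
  "\<exists>\<beta>. linear_map A0 \<Omega>tot F\<Omega> \<beta> \<and> (\<forall>a\<in>carrier A. \<beta> (dtot a) = E.t (K.d (\<pi> a)) \<one>\<^bsub>A0\<^esub>)"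
proof (rule tot_univ[OF E.P_module])
  interpret P: module A0 F\<Omega> by (rule E.P_module)
  have t_mid: "E.t (b \<odot>\<^bsub>K.\<Omega>\<^esub> m) \<one>\<^bsub>A0\<^esub> = b [^]\<^bsub>A0\<^esub> p \<odot>\<^bsub>F\<Omega>\<^esub> E.t m \<one>\<^bsub>A0\<^esub>"
    if "b \<in> carrier A0" "m \<in> carrier K.\<Omega>" for b m
    using that E.tensor_balanced[of b m "\<one>\<^bsub>A0\<^esub>"] E.tensor_smult[of "b [^]\<^bsub>A0\<^esub> p" m "\<one>\<^bsub>A0\<^esub>"] by simp
  have pA0: "E.t (K.d (\<pi> pA)) \<one>\<^bsub>A0\<^esub> = \<zero>\<^bsub>F\<Omega>\<^esub>"
    by (simp add: \<pi>_pA d_zero tensor_zero)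
  show "E.t (K.d (\<pi> a)) \<one>\<^bsub>A0\<^esub> \<in> carrier F\<Omega>" if "a \<in> carrier A" for a
    using that by (simp add: E.tensor_closed K.d_closed)
  show "E.t (K.d (\<pi> (a \<oplus>\<^bsub>A\<^esub> b))) \<one>\<^bsub>A0\<^esub> =
      E.t (K.d (\<pi> a)) \<one>\<^bsub>A0\<^esub> \<oplus>\<^bsub>F\<Omega>\<^esub> E.t (K.d (\<pi> b)) \<one>\<^bsub>A0\<^esub> \<oplus>\<^bsub>F\<Omega>\<^esub>
      Cp A0 p (\<pi> a) (\<pi> b) \<odot>\<^bsub>F\<Omega>\<^esub> E.t (K.d (\<pi> pA)) \<one>\<^bsub>A0\<^esub>"
    if "a \<in> carrier A" "b \<in> carrier A" for a b
    unfolding pA0 using that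
    by (simp add: K.d_add E.tensor_add_left E.tensor_closed K.d_closed)
  show "E.t (K.d (\<pi> (a \<otimes>\<^bsub>A\<^esub> b))) \<one>\<^bsub>A0\<^esub> =
      \<pi> b [^]\<^bsub>A0\<^esub> p \<odot>\<^bsub>F\<Omega>\<^esub> E.t (K.d (\<pi> a)) \<one>\<^bsub>A0\<^esub> \<oplus>\<^bsub>F\<Omega>\<^esub>
      \<pi> a [^]\<^bsub>A0\<^esub> p \<odot>\<^bsub>F\<Omega>\<^esub> E.t (K.d (\<pi> b)) \<one>\<^bsub>A0\<^esub>"
    if "a \<in> carrier A" "b \<in> carrier A" for a b
    using that by (simp add: K.d_mult E.tensor_add_left t_mid K.d_closed)
  show "E.t (K.d (\<pi> (r \<odot>\<^bsub>A\<^esub> \<one>\<^bsub>A\<^esub>))) \<one>\<^bsub>A0\<^esub> = \<iota> (snd r) \<odot>\<^bsub>F\<Omega>\<^esub> E.t (K.d (\<pi> pA)) \<one>\<^bsub>A0\<^esub>"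
    if r: "r \<in> carrier kp.W" for r
  proof -
    have "fst r \<in> carrier k" "snd r \<in> carrier k" using r by auto
    thus ?thesis
      using K.d_const[of "fst r"] unfolding pA0 \<pi>_unit[OF r] by (simp add: A0_smult tensor_zero)
  qed
qed

text \<open>The \<open>m\<close> whose tensor with \<open>1\<close> is hit form a submodule:
  \<open>b m \<otimes> 1\<close> is \<open>b^p\<close> times \<open>m \<otimes> 1\<close>. It
  contains all differentials, as \<open>\<pi>\<close> is surjective, so it is everything; general
  tensors are multiples of these.\<close>

lemma \<beta>_surj:
  assumes "linear_map A0 \<Omega>tot F\<Omega> \<beta>"
    and \<beta>: "\<And>a. a \<in> carrier A \<Longrightarrow> \<beta> (dtot a) = E.t (K.d (\<pi> a)) \<one>\<^bsub>A0\<^esub>"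
  shows "\<beta> ` carrier \<Omega>tot = carrier F\<Omega>"
proof
  interpret \<beta>: linear_map A0 \<Omega>tot F\<Omega> \<beta> by fact
  let ?im = "\<beta> ` carrier \<Omega>tot"
  note im = \<beta>.submodule_image
  show "?im \<subseteq> carrier F\<Omega>" by auto
  have "submodule {m \<in> carrier K.\<Omega>. E.t m \<one>\<^bsub>A0\<^esub> \<in> ?im} A0 K.\<Omega>"
  proof (rule E.M.submoduleI)
    have smult: "E.t (b \<odot>\<^bsub>K.\<Omega>\<^esub> m) \<one>\<^bsub>A0\<^esub> \<in> ?im"
      if "b \<in> carrier A0" "m \<in> carrier K.\<Omega>" "E.t m \<one>\<^bsub>A0\<^esub> \<in> ?im" for b m
      using that E.tensor_balanced[of b m "\<one>\<^bsub>A0\<^esub>"] E.tensor_smult[of "b [^]\<^bsub>A0\<^esub> p" m "\<one>\<^bsub>A0\<^esub>"]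
        submodule.smult_closed[OF im, of "b [^]\<^bsub>A0\<^esub> p" "E.t m \<one>\<^bsub>A0\<^esub>"] by simp
    thus "b \<odot>\<^bsub>K.\<Omega>\<^esub> m \<in> {m \<in> carrier K.\<Omega>. E.t m \<one>\<^bsub>A0\<^esub> \<in> ?im}"
      if "b \<in> carrier A0" "m \<in> {m \<in> carrier K.\<Omega>. E.t m \<one>\<^bsub>A0\<^esub> \<in> ?im}" for b m
      using that by auto
    show "\<ominus>\<^bsub>K.\<Omega>\<^esub> m \<in> {m \<in> carrier K.\<Omega>. E.t m \<one>\<^bsub>A0\<^esub> \<in> ?im}"
      if m: "m \<in> {m \<in> carrier K.\<Omega>. E.t m \<one>\<^bsub>A0\<^esub> \<in> ?im}" for m
    proof -
      \<comment> \<open>Writing negation as multiplication by \<open>-1\<close> reduces it to the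
        scalar case just shown.\<close>
      have "\<ominus>\<^bsub>K.\<Omega>\<^esub> m = (\<ominus>\<^bsub>A0\<^esub> \<one>\<^bsub>A0\<^esub>) \<odot>\<^bsub>K.\<Omega>\<^esub> m" using m by (simp add: E.M.smult_l_minus)
      thus ?thesis using m smult[of "\<ominus>\<^bsub>A0\<^esub> \<one>\<^bsub>A0\<^esub>" m] by simp
    qed
    show "m \<oplus>\<^bsub>K.\<Omega>\<^esub> m' \<in> {m \<in> carrier K.\<Omega>. E.t m \<one>\<^bsub>A0\<^esub> \<in> ?im}"
      if "m \<in> {m \<in> carrier K.\<Omega>. E.t m \<one>\<^bsub>A0\<^esub> \<in> ?im}" "m' \<in> {m \<in> carrier K.\<Omega>. E.t m \<one>\<^bsub>A0\<^esub> \<in> ?im}"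
      for m m'
      using that \<beta>.N.submoduleE(5)[OF im] by (simp add: E.tensor_add_left)
    show "\<zero>\<^bsub>K.\<Omega>\<^esub> \<in> {m \<in> carrier K.\<Omega>. E.t m \<one>\<^bsub>A0\<^esub> \<in> ?im}"
      using \<beta>.N.submodule_zero[OF im] by (simp add: tensor_zero)
  qed auto
  moreover have "E.t (K.d x) \<one>\<^bsub>A0\<^esub> \<in> ?im" if x: "x \<in> carrier A0" for x
  proof -
    obtain a where a: "a \<in> carrier A" "x = \<pi> a" using x unfolding \<pi>_surj by blast
    show ?thesis unfolding a(2) \<beta>[OF a(1), symmetric] by (rule imageI[OF dtot_closed[OF a(1)]])
  qed
  ultimately have one: "carrier K.\<Omega> \<subseteq> {m \<in> carrier K.\<Omega>. E.t m \<one>\<^bsub>A0\<^esub> \<in> ?im}"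
    by (intro K.kaehler_generated) (simp_all add: K.d_closed)
  show "carrier F\<Omega> \<subseteq> ?im"
  proof (rule E.tensor_generated[OF im])
    fix m s assume ms: "m \<in> carrier K.\<Omega>" "s \<in> carrier A0"
    hence "E.t m \<one>\<^bsub>A0\<^esub> \<in> ?im" using one by blast
    from submodule.smult_closed[OF im ms(2) this]
    show "E.t m s \<in> ?im" using E.tensor_smult[of s m "\<one>\<^bsub>A0\<^esub>"] ms by simp
  qed
qed

section \<open>The quotient by the differential of \<open>p\<close> and the kernel of
  \<open>\<beta>\<close>\<close>

lemma dpA_submodule: "submodule dpA A0 \<Omega>tot"
  by (rule module.submodule_gen_submodule[OF \<Omega>tot_module]) (simp add: dtot_closed)

sublocale Q: quotient_module A0 \<Omega>tot dpA
  by (intro quotient_module.intro \<Omega>tot_module dpA_submodule)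

abbreviation "dq a \<equiv> dpA +>\<^bsub>\<Omega>tot\<^esub> dtot a"

lemma
  shows dq_closed: "a \<in> carrier A \<Longrightarrow> dq a \<in> carrier Q.Q"
    and dq_add: "a \<in> carrier A \<Longrightarrow> b \<in> carrier A \<Longrightarrow> dq (a \<oplus>\<^bsub>A\<^esub> b) = dq a \<oplus>\<^bsub>Q.Q\<^esub> dq b"
    and dq_mult: "a \<in> carrier A \<Longrightarrow> b \<in> carrier A \<Longrightarrow> dq (a \<otimes>\<^bsub>A\<^esub> b) =
      \<pi> b [^]\<^bsub>A0\<^esub> p \<odot>\<^bsub>Q.Q\<^esub> dq a \<oplus>\<^bsub>Q.Q\<^esub> \<pi> a [^]\<^bsub>A0\<^esub> p \<odot>\<^bsub>Q.Q\<^esub> dq b"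
    and dq_unit: "r \<in> carrier kp.W \<Longrightarrow> dq (r \<odot>\<^bsub>A\<^esub> \<one>\<^bsub>A\<^esub>) = \<zero>\<^bsub>Q.Q\<^esub>"
proof -
  interpret c: linear_map A0 \<Omega>tot Q.Q "\<lambda>x. dpA +>\<^bsub>\<Omega>tot\<^esub> x" by (rule Q.proj_linear)
  have p: "dq pA = \<zero>\<^bsub>Q.Q\<^esub>"
    using submodule_gen_incl[of "{dtot pA}" A0 \<Omega>tot] Q.proj_eq_zero_iff[OF dtot_closed[OF pA_closed]]
    by blast
  note [simp] = dtot_closed p
  show "dq a \<in> carrier Q.Q" if "a \<in> carrier A" using that by simp
  show "dq (a \<oplus>\<^bsub>A\<^esub> b) = dq a \<oplus>\<^bsub>Q.Q\<^esub> dq b" if "a \<in> carrier A" "b \<in> carrier A"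
    using that by (simp add: dtot_add)
  show "dq (a \<otimes>\<^bsub>A\<^esub> b) =
      \<pi> b [^]\<^bsub>A0\<^esub> p \<odot>\<^bsub>Q.Q\<^esub> dq a \<oplus>\<^bsub>Q.Q\<^esub> \<pi> a [^]\<^bsub>A0\<^esub> p \<odot>\<^bsub>Q.Q\<^esub> dq b"
    if "a \<in> carrier A" "b \<in> carrier A"
    using that by (simp add: dtot_mult)
  show "dq (r \<odot>\<^bsub>A\<^esub> \<one>\<^bsub>A\<^esub>) = \<zero>\<^bsub>Q.Q\<^esub>" if r: "r \<in> carrier kp.W"
  proof -
    have "snd r \<in> carrier k" using r by auto
    thus ?thesis using r by (simp add: dtot_unit del: kp.witt2_simps)
  qed
qed

text \<open>The generators of \<open>I\<close> are constants, hence killed by \<open>dq\<close>. To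
  pass to all of \<open>I\<close>, note that for \<open>i\<close> in \<open>I\<close> both terms of
  the Leibniz rule for \<open>x \<otimes> i\<close> vanish: \<open>\<pi> i\<close> is zero and so is
  \<open>dq i\<close>.\<close>

lemma dq_cong:
  assumes a: "a \<in> carrier A" and b: "b \<in> carrier A" and eq: "\<pi> a = \<pi> b"
  shows "dq a = dq b"
proof -
  interpret QM: module A0 Q.Q by (rule Q.module_quot)
  \<comment> \<open>Membership in \<open>I\<close> is part of \<open>Z\<close> so that
    \<open>\<pi> i\<close> is known to vanish when the Leibniz rule is applied.\<close>
  define Z where "Z = {i \<in> I. dq i = \<zero>\<^bsub>Q.Q\<^esub>}"
  have IA: "i \<in> carrier A" if "i \<in> I" for i using that by simp
  have mult: "x \<otimes>\<^bsub>A\<^esub> i \<in> Z" if "i \<in> Z" "x \<in> carrier A" for i x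
    using that IA[of i] \<pi>_eq_zero[of i] by (simp add: Z_def dq_mult dq_closed I.I_l_closed)
  have "ideal Z A"
  proof (rule idealI[OF AR.ring_axioms])
    show "x \<otimes>\<^bsub>A\<^esub> i \<in> Z" if "i \<in> Z" "x \<in> carrier A" for i x using that by (rule mult)
    show "i \<otimes>\<^bsub>A\<^esub> x \<in> Z" if "i \<in> Z" "x \<in> carrier A" for i x
      using mult[OF that] that IA by (simp add: AR.m_comm Z_def)
    show "subgroup Z (add_monoid A)"
    proof (rule AR.add.subgroupI)
      show "Z \<subseteq> carrier A" using IA by (auto simp: Z_def)
      have "dq (\<zero>\<^bsub>kp.W\<^esub> \<odot>\<^bsub>A\<^esub> \<one>\<^bsub>A\<^esub>) = \<zero>\<^bsub>Q.Q\<^esub>" by (rule dq_unit) simp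
      moreover have "\<zero>\<^bsub>kp.W\<^esub> \<odot>\<^bsub>A\<^esub> \<one>\<^bsub>A\<^esub> = \<zero>\<^bsub>A\<^esub>" by (rule A.smult_l_null) simp
      ultimately have "\<zero>\<^bsub>A\<^esub> \<in> Z" by (simp add: Z_def)
      thus "Z \<noteq> {}" by blast
      show "i \<oplus>\<^bsub>A\<^esub> j \<in> Z" if "i \<in> Z" "j \<in> Z" for i j
        using that IA by (simp add: Z_def dq_add)
      show "\<ominus>\<^bsub>A\<^esub> i \<in> Z" if i: "i \<in> Z" for i
      proof -
        have "\<ominus>\<^bsub>A\<^esub> i = \<ominus>\<^bsub>A\<^esub> \<one>\<^bsub>A\<^esub> \<otimes>\<^bsub>A\<^esub> i" using i IA by (simp add: Z_def AR.l_minus)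
        thus ?thesis using mult[OF i, of "\<ominus>\<^bsub>A\<^esub> \<one>\<^bsub>A\<^esub>"] by simp
      qed
    qed
  qed
  moreover have "{r \<odot>\<^bsub>A\<^esub> \<one>\<^bsub>A\<^esub> | r. r \<in> carrier kp.W \<and> fst r = \<zero>\<^bsub>k\<^esub>} \<subseteq> Z"
    using AR.genideal_self[OF I_gens] dq_unit unfolding Z_def red_ideal_def by blast
  ultimately have "I \<subseteq> Z"
    unfolding red_ideal_def by (rule AR.genideal_minimal)
  hence ab: "dq (a \<ominus>\<^bsub>A\<^esub> b) = \<zero>\<^bsub>Q.Q\<^esub>" using eq a b by (auto simp: \<pi>_eq_iff Z_def)
  have "dq a = dq ((a \<ominus>\<^bsub>A\<^esub> b) \<oplus>\<^bsub>A\<^esub> b)"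
    using a b by (simp add: a_minus_def AR.a_assoc AR.l_neg)
  also have "\<dots> = dq b" using a b by (simp add: dq_add ab dq_closed)
  finally show ?thesis .
qed

text \<open>A candidate inverse to the map that \<open>\<beta>\<close> induces on the quotient by
  \<open>dtot pA\<close>; it detects which elements \<open>\<beta>\<close> kills.\<close>

lemma ex_\<gamma>:
  "\<exists>\<gamma>. linear_map A0 F\<Omega> Q.Q \<gamma> \<and> (\<forall>a\<in>carrier A. \<gamma> (E.t (K.d (\<pi> a)) \<one>\<^bsub>A0\<^esub>) = dq a)"
proof -
  interpret QM: module A0 Q.Q by (rule Q.module_quot)
  \<comment> \<open>Scalars act on \<open>N\<close> through the Frobenius, so the Leibniz rule with
    \<open>p\<close>-th powers is an ordinary one in \<open>N\<close>.\<close>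
  define N where "N = Q.Q\<lparr>smult := \<lambda>b x. b [^]\<^bsub>A0\<^esub> p \<odot>\<^bsub>Q.Q\<^esub> x\<rparr>"
  have N: "module A0 N"
    unfolding N_def by (rule module_restrict_scalars[OF Q.module_quot A0.cring_axioms A0p.frob_hom])
  have N_simps: "carrier N = carrier Q.Q" "x \<oplus>\<^bsub>N\<^esub> y = x \<oplus>\<^bsub>Q.Q\<^esub> y" "\<zero>\<^bsub>N\<^esub> = \<zero>\<^bsub>Q.Q\<^esub>"
    "b \<odot>\<^bsub>N\<^esub> x = b [^]\<^bsub>A0\<^esub> p \<odot>\<^bsub>Q.Q\<^esub> x" for x y b
    by (simp_all add: N_def)
  \<comment> \<open>The choice of a lift of \<open>x\<close> to \<open>A\<close> does not matter, by
    \<open>dq_cong\<close>.\<close>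
  define D where "D x = dq (SOME a. a \<in> carrier A \<and> \<pi> a = x)" for x
  have D: "D (\<pi> a) = dq a" if a: "a \<in> carrier A" for a
  proof -
    have "(SOME b. b \<in> carrier A \<and> \<pi> b = \<pi> a) \<in> carrier A \<and>
        \<pi> (SOME b. b \<in> carrier A \<and> \<pi> b = \<pi> a) = \<pi> a"
      by (rule someI[of _ a]) (use a in simp)
    thus ?thesis unfolding D_def using a by (intro dq_cong) auto
  qed
  have "\<exists>g. linear_map A0 K.\<Omega> N g \<and> (\<forall>x\<in>carrier A0. g (K.d x) = D x)"
  proof (rule K.kaehler_univ[OF N], unfold N_simps)
    show "D x \<in> carrier Q.Q" if "x \<in> carrier A0" for x
      using that dq_closed D unfolding \<pi>_surj by auto
    fix x y assume "x \<in> carrier A0" "y \<in> carrier A0"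
    then obtain a b where ab: "a \<in> carrier A" "x = \<pi> a" "b \<in> carrier A" "y = \<pi> b"
      unfolding \<pi>_surj by blast
    show "D (x \<oplus>\<^bsub>A0\<^esub> y) = D x \<oplus>\<^bsub>Q.Q\<^esub> D y"
      using ab by (simp add: D dq_add flip: \<pi>.hom_add)
    have "D (\<pi> a \<otimes>\<^bsub>A0\<^esub> \<pi> b) = dq (a \<otimes>\<^bsub>A\<^esub> b)"
      using ab D[of "a \<otimes>\<^bsub>A\<^esub> b"] by simp
    thus "D (x \<otimes>\<^bsub>A0\<^esub> y) = y [^]\<^bsub>A0\<^esub> p \<odot>\<^bsub>Q.Q\<^esub> D x \<oplus>\<^bsub>Q.Q\<^esub> x [^]\<^bsub>A0\<^esub> p \<odot>\<^bsub>Q.Q\<^esub> D y"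
      using ab by (simp add: D dq_mult)
  next
    fix c assume c: "c \<in> carrier k"
    hence W: "(c, \<zero>\<^bsub>k\<^esub>) \<in> carrier kp.W" by simp
    have "c \<odot>\<^bsub>A0\<^esub> \<one>\<^bsub>A0\<^esub> = \<pi> ((c, \<zero>\<^bsub>k\<^esub>) \<odot>\<^bsub>A\<^esub> \<one>\<^bsub>A\<^esub>)"
      using c by (simp add: A0_smult \<pi>_unit[OF W])
    thus "D (c \<odot>\<^bsub>A0\<^esub> \<one>\<^bsub>A0\<^esub>) = \<zero>\<^bsub>Q.Q\<^esub>"
      using D[OF unit_closed[OF W]] dq_unit[OF W] by simp
  qed
  then obtain g where "linear_map A0 K.\<Omega> N g" and g: "\<And>x. x \<in> carrier A0 \<Longrightarrow> g (K.d x) = D x"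
    by blast
  interpret g: linear_map A0 K.\<Omega> N g by fact
  have "\<exists>\<gamma>. linear_map A0 F\<Omega> Q.Q \<gamma> \<and>
      (\<forall>m\<in>carrier K.\<Omega>. \<forall>s\<in>carrier A0. \<gamma> (E.t m s) = s \<odot>\<^bsub>Q.Q\<^esub> g m)"
    by (rule E.tensor_univ[OF Q.module_quot])
      (use g.closed g.add g.smult in \<open>simp_all add: N_simps\<close>)
  then obtain \<gamma> where "linear_map A0 F\<Omega> Q.Q \<gamma>"
    and \<gamma>: "\<And>m s. m \<in> carrier K.\<Omega> \<Longrightarrow> s \<in> carrier A0 \<Longrightarrow> \<gamma> (E.t m s) = s \<odot>\<^bsub>Q.Q\<^esub> g m"
    by blast
  moreover have "\<gamma> (E.t (K.d (\<pi> a)) \<one>\<^bsub>A0\<^esub>) = dq a" if a: "a \<in> carrier A" for a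
    using a by (simp add: \<gamma> K.d_closed g D dq_closed)
  ultimately show ?thesis by blast
qed

text \<open>The composite of \<open>\<gamma>\<close> with \<open>\<beta>\<close> agrees on
  generators with the projection modulo \<open>dpA\<close>, hence equals it, so whatever
  \<open>\<beta>\<close> kills lies in \<open>dpA\<close>. Conversely \<open>\<beta>\<close> kills
  \<open>dtot pA\<close>, as \<open>pA\<close> reduces to zero.\<close>

lemma \<beta>_kernel:
  assumes "linear_map A0 \<Omega>tot F\<Omega> \<beta>"
    and \<beta>: "\<And>a. a \<in> carrier A \<Longrightarrow> \<beta> (dtot a) = E.t (K.d (\<pi> a)) \<one>\<^bsub>A0\<^esub>"
  shows "a_kernel \<Omega>tot F\<Omega> \<beta> = dpA"
proof
  interpret \<beta>: linear_map A0 \<Omega>tot F\<Omega> \<beta> by fact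
  obtain \<gamma> where "linear_map A0 F\<Omega> Q.Q \<gamma>"
    and \<gamma>: "\<And>a. a \<in> carrier A \<Longrightarrow> \<gamma> (E.t (K.d (\<pi> a)) \<one>\<^bsub>A0\<^esub>) = dq a"
    using ex_\<gamma> by blast
  interpret \<gamma>: linear_map A0 F\<Omega> Q.Q \<gamma> by fact
  have "linear_map A0 \<Omega>tot Q.Q (\<gamma> \<circ> \<beta>)"
    by (intro linear_mapI \<Omega>tot_module Q.module_quot mod_hom_comp[OF \<beta>.f \<gamma>.f])
  from mod_hom_eq_submodule[OF this Q.proj_linear]
  have "carrier \<Omega>tot \<subseteq> {x \<in> carrier \<Omega>tot. (\<gamma> \<circ> \<beta>) x = dpA +>\<^bsub>\<Omega>tot\<^esub> x}"
    by (rule tot_generated) (simp add: dtot_closed \<beta> \<gamma>)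
  hence eq: "\<gamma> (\<beta> x) = dpA +>\<^bsub>\<Omega>tot\<^esub> x" if "x \<in> carrier \<Omega>tot" for x using that by auto
  show "a_kernel \<Omega>tot F\<Omega> \<beta> \<subseteq> dpA"
  proof
    fix x assume "x \<in> a_kernel \<Omega>tot F\<Omega> \<beta>"
    hence x: "x \<in> carrier \<Omega>tot" "\<beta> x = \<zero>\<^bsub>F\<Omega>\<^esub>" by (auto simp: \<beta>.kernel_eq)
    show "x \<in> dpA" using eq[OF x(1)] Q.proj_eq_zero_iff[OF x(1)] by (simp add: x(2))
  qed
  have "submodule (a_kernel \<Omega>tot F\<Omega> \<beta>) A0 \<Omega>tot"
    using \<beta>.submodule_vimage[OF \<beta>.N.zero_submodule] by (simp add: \<beta>.kernel_eq)
  moreover have "dtot pA \<in> a_kernel \<Omega>tot F\<Omega> \<beta>"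
    using \<beta>[OF pA_closed] by (simp add: \<beta>.kernel_eq dtot_closed \<pi>_pA d_zero tensor_zero)
  ultimately show "dpA \<subseteq> a_kernel \<Omega>tot F\<Omega> \<beta>"
    by (intro submodule_gen_minimal) simp_all
qed

section \<open>The retraction of \<open>\<alpha>\<close>\<close>

text \<open>A finite presentation makes \<open>A0\<close> an image of a polynomial algebra whose
  elements are functions on \<open>nat multiset\<close>. Choosing preimages embeds \<open>A0\<close>
  among these functions, and pairs of them are encoded as sets.\<close>

lemma ex_encoding:
  assumes "finitely_presented kp.W A"
  shows "\<exists>enc :: 'a set \<times> 'a set \<Rightarrow> (nat multiset \<Rightarrow> 'k \<times> 'k) set. inj_on enc (carrier A0p.W)"
proof -
  obtain n :: nat and \<theta> where \<theta>: "\<theta> ` carrier (mpoly_algebra kp.W {..<n}) = carrier A"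
    using assms unfolding finitely_presented_def by blast
  have "carrier A0 \<subseteq> (\<pi> \<circ> \<theta>) ` carrier (mpoly_algebra kp.W {..<n})"
    unfolding image_comp[symmetric] \<theta> \<pi>_surj by simp
  from inj_on_pair_encoding[OF this] show ?thesis by simp
qed

text \<open>Functoriality of \<open>W_2\<close> along \<open>\<iota>\<close> supplies the algebra
  structure. The kernel of \<open>fst\<close> has square zero because the product of
  \<open>(0, b)\<close> and \<open>(0, d)\<close> carries factors \<open>0^p\<close>. The values on
  constants will give the third family of relations.\<close>

lemma ex_witt2_lift:
  assumes "smooth_algebra kp.W A"
  shows "\<exists>g\<in>ring_hom A A0p.W. (\<forall>a\<in>carrier A. fst (g a) = \<pi> a) \<and>
    (\<forall>r\<in>carrier kp.W. g (r \<odot>\<^bsub>A\<^esub> \<one>\<^bsub>A\<^esub>) = (\<iota> (fst r), \<iota> (snd r)))"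
proof -
  have fp: "finitely_presented kp.W A"
    and fs: "formally_smooth TYPE((nat multiset \<Rightarrow> 'k \<times> 'k) set) kp.W A"
    using assms unfolding smooth_algebra_def by blast+
  obtain enc :: "'a set \<times> 'a set \<Rightarrow> (nat multiset \<Rightarrow> 'k \<times> 'k) set"
    where enc: "inj_on enc (carrier A0p.W)" using ex_encoding[OF fp] by blast
  have "(\<lambda>(a, b). (\<iota> a, \<iota> b)) \<in> ring_hom kp.W A0p.W"
    by (rule witt2_hom[OF kp.char_p_ring_axioms A0p.char_p_ring_axioms \<iota>_hom])
  moreover have "fst \<in> ring_hom A0p.W A0"
    by (rule ring_hom_memI) auto
  moreover have "fst ` carrier A0p.W = carrier A0"
    using A0.zero_closed by force
  moreover have "x \<otimes>\<^bsub>A0p.W\<^esub> y = \<zero>\<^bsub>A0p.W\<^esub>"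
    if "x \<in> carrier A0p.W" "y \<in> carrier A0p.W" "fst x = \<zero>\<^bsub>A0\<^esub>" "fst y = \<zero>\<^bsub>A0\<^esub>" for x y
    using that by auto
  moreover have "\<pi> (r \<odot>\<^bsub>A\<^esub> \<one>\<^bsub>A\<^esub>) = fst (case r of (a, b) \<Rightarrow> (\<iota> a, \<iota> b))"
    if "r \<in> carrier kp.W" for r
    using \<pi>_unit[OF that] by (simp add: case_prod_unfold)
  ultimately show ?thesis
    using formally_smooth_lift[OF fs A.algebra_axioms A0p.witt2_cring A0.cring_axioms enc,
        of "\<lambda>(a, b). (\<iota> a, \<iota> b)" fst \<pi>] \<pi>_hom
    by (simp add: case_prod_unfold)
qed

lemma self_module_module: "module A0 (self_module A0)"
  by (rule algebra.module[OF algebra_algebra_via])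
    (auto intro: A0.cring_axioms ring_hom_memI)

text \<open>Write the lift as \<open>a \<mapsto> (\<pi> a, \<delta> a)\<close>. Comparing second
  components shows \<open>\<delta>\<close> to be a \<open>p\<close>-derivation with values in
  \<open>A0\<close>, and \<open>\<delta> pA = 1\<close> turns its carry term into the multiple of
  \<open>\<delta> pA\<close> that the sum relation demands.\<close>

lemma ex_retraction:
  assumes "smooth_algebra kp.W A"
  shows "\<exists>\<delta>. linear_map A0 \<Omega>tot (self_module A0) \<delta> \<and> \<delta> (dtot pA) = \<one>\<^bsub>A0\<^esub>"
proof -
  obtain g where g: "g \<in> ring_hom A A0p.W" and fst: "\<And>a. a \<in> carrier A \<Longrightarrow> fst (g a) = \<pi> a"
    and unit: "\<And>r. r \<in> carrier kp.W \<Longrightarrow> g (r \<odot>\<^bsub>A\<^esub> \<one>\<^bsub>A\<^esub>) = (\<iota> (fst r), \<iota> (snd r))"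
    using ex_witt2_lift[OF assms] by blast
  define \<delta> where "\<delta> a = snd (g a)" for a
  have geq: "g a = (\<pi> a, \<delta> a)" if "a \<in> carrier A" for a
    using fst[OF that] by (simp add: \<delta>_def prod_eq_iff)
  have closed: "\<delta> a \<in> carrier A0" if "a \<in> carrier A" for a
    using ring_hom_closed[OF g that] by (simp add: geq[OF that])
  have \<delta>_pA: "\<delta> pA = \<one>\<^bsub>A0\<^esub>"
    unfolding \<delta>_def pA_eq by (subst unit) simp_all
  have "\<exists>h. linear_map A0 \<Omega>tot (self_module A0) h \<and> (\<forall>a\<in>carrier A. h (dtot a) = \<delta> a)"
  proof (rule tot_univ[OF self_module_module], unfold algebra_via_simps \<delta>_pA)
    show "\<delta> a \<in> carrier A0" if "a \<in> carrier A" for a using that by (rule closed)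
    fix a b assume ab: "a \<in> carrier A" "b \<in> carrier A"
    show "\<delta> (a \<oplus>\<^bsub>A\<^esub> b) = \<delta> a \<oplus>\<^bsub>A0\<^esub> \<delta> b \<oplus>\<^bsub>A0\<^esub> Cp A0 p (\<pi> a) (\<pi> b) \<otimes>\<^bsub>A0\<^esub> \<one>\<^bsub>A0\<^esub>"
      using ring_hom_add[OF g ab] ab by (simp add: geq)
    show "\<delta> (a \<otimes>\<^bsub>A\<^esub> b) = \<pi> b [^]\<^bsub>A0\<^esub> p \<otimes>\<^bsub>A0\<^esub> \<delta> a \<oplus>\<^bsub>A0\<^esub> \<pi> a [^]\<^bsub>A0\<^esub> p \<otimes>\<^bsub>A0\<^esub> \<delta> b"
      using ring_hom_mult[OF g ab] ab by (simp add: geq closed A0.a_comm)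
  next
    fix r assume r: "r \<in> carrier kp.W"
    hence "snd r \<in> carrier k" by auto
    thus "\<delta> (r \<odot>\<^bsub>A\<^esub> \<one>\<^bsub>A\<^esub>) = \<iota> (snd r) \<otimes>\<^bsub>A0\<^esub> \<one>\<^bsub>A0\<^esub>"
      using unit[OF r] by (simp add: \<delta>_def)
  qed
  thus ?thesis using \<delta>_pA by auto
qed

end

theorem mainTheorem4:
  fixes k :: "('k, 'x) ring_scheme"
    and A :: "('k \<times> 'k, 'a, 'y) module_scheme"
    and p :: nat
  assumes "field k" and "has_char k p" and "p > 2"
    and "smooth_algebra (witt2 p k) A"
  shows "let A0 = reduction k p A; \<pi>0 = red_map k p A;
             \<Omega>tot = tot_diff k p A; dtot = tot_d k p A; pA = [p] \<cdot>\<^bsub>A\<^esub> \<one>\<^bsub>A\<^esub>;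
             \<Omega>0 = kaehler k A0; d0 = kaehler_d k A0;
             \<alpha> = (\<lambda>x. x \<odot>\<^bsub>\<Omega>tot\<^esub> dtot pA)
         in \<exists>\<beta>. short_exact_modules A0 (self_module A0) \<Omega>tot (frob_pullback p A0 \<Omega>0) \<alpha> \<beta>
              \<and> a_kernel \<Omega>tot (frob_pullback p A0 \<Omega>0) \<beta> = submodule_gen A0 \<Omega>tot {dtot pA}
              \<and> (\<forall>a\<in>carrier A. \<beta> (dtot a) = frob_tensor p A0 \<Omega>0 (d0 (\<pi>0 a)) \<one>\<^bsub>A0\<^esub>)"
proof -
  have alg: "algebra (witt2 p k) A" using assms(4) by (simp add: smooth_algebra_def)
  interpret witt_algebra k p A
    using assms(1-3) alg algebra.M_cring[OF alg]
    by (simp add: witt_algebra_def witt_algebra_axioms_def)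
  obtain \<beta> where lin: "linear_map A0 \<Omega>tot F\<Omega> \<beta>"
    and \<beta>: "\<And>a. a \<in> carrier A \<Longrightarrow> \<beta> (dtot a) = E.t (K.d (\<pi> a)) \<one>\<^bsub>A0\<^esub>"
    using ex_\<beta> by blast
  interpret \<beta>: linear_map A0 \<Omega>tot F\<Omega> \<beta> by (rule lin)
  obtain \<delta> where "linear_map A0 \<Omega>tot (self_module A0) \<delta>" and \<delta>_pA: "\<delta> (dtot pA) = \<one>\<^bsub>A0\<^esub>"
    using ex_retraction[OF assms(4)] by blast
  interpret \<delta>: linear_map A0 \<Omega>tot "self_module A0" \<delta> by fact
  let ?\<alpha> = "\<lambda>x. x \<odot>\<^bsub>\<Omega>tot\<^esub> dtot pA"
  have pA: "dtot pA \<in> carrier \<Omega>tot" by (rule dtot_closed[OF pA_closed])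
  have ker: "a_kernel \<Omega>tot F\<Omega> \<beta> = dpA" by (rule \<beta>_kernel[OF lin \<beta>])
  have "?\<alpha> \<in> mod_hom A0 (self_module A0) \<Omega>tot"
    using pA by (auto simp: mod_hom_def Q.smult_l_distr Q.smult_assoc1)
  moreover have "inj_on ?\<alpha> (carrier (self_module A0))"
  proof (rule inj_on_inverseI)
    fix x assume "x \<in> carrier (self_module A0)"
    thus "\<delta> (?\<alpha> x) = x" using pA by (simp add: \<delta>_pA)
  qed
  moreover have "?\<alpha> ` carrier (self_module A0) = a_kernel \<Omega>tot F\<Omega> \<beta>"
    unfolding ker Q.submodule_gen_singleton[OF pA] by simp
  ultimately have "short_exact_modules A0 (self_module A0) \<Omega>tot F\<Omega> ?\<alpha> \<beta>"
    unfolding short_exact_modules_def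
    using self_module_module \<Omega>tot_module E.P_module \<beta>.f \<beta>_surj[OF lin \<beta>] by simp
  thus ?thesis unfolding Let_def using ker \<beta> by blast
qed

end
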